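(* Let $\alpha, c, s$ be complex numbers with $c\notin[0,\infty)$ and $s=a+ib$, $a>0$, $b\in\mathbb{R}$; let $m>0$ and $f,g\in\mathcal{A}$. Suppose there exists a function $h$, analytic in $\mathcal{U}$, with $h(0)=h_0$, $h_0\in\mathbb{C}$, $h_0\notin(-\infty,0]$, such that the inequalities $$\left|\alpha-\frac{m}{2a}\right|<\frac{m}{2a},$$ $$\left|\frac{c}{h(z)}+\frac{m}{2\alpha}\right|<\frac{m}{2|\alpha|},$$ and $$\left|\frac{-c\alpha}{a h(z)}|z|^{m/a}+\left(1-|z|^{m/a}\right)\left[(\alpha-1)\frac{zg'(z)}{g(z)}+1+\frac{zf''(z)}{f'(z)}+\frac{zh'(z)}{h(z)}\right]-\frac{m}{2a}\right|\le\frac{m}{2a}$$ hold for all $z\in\mathcal{U}$. Then the function $$G_\alpha(z)=\left[\alpha\int_0^z g^{\alpha-1}(u)f'(u)\,du\right]^{1/\alpha}$$ is analytic and univalent in $\mathcal{U}$, where the principal branch is intended.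
   Context: $\mathcal{U}=\{z\in\mathbb{C}:|z|<1\}$. $\mathcal{A}$ is the class of functions $f$ analytic in $\mathcal{U}$ with $f(0)=0$, $f'(0)=1$. Univalent means injective. The quotient $zg'(z)/g(z)$ is taken to be $1$ at $z=0$. The inequalities presuppose that the quotients in them are defined, i.e. for all $z\in\mathcal{U}$: $h(z)\neq0$, $f'(z)\neq0$, and (when $\alpha\ne1$) $g(z)\neq0$ for $z\neq0$. Meaning of $G_\alpha$ and its branch: write $g^{\alpha-1}(u)=u^{\alpha-1}(g(u)/u)^{\alpha-1}$, where $g(u)/u$ has value $1$ at $u=0$ and $(g(u)/u)^{\alpha-1}$ is the branch equal to $1$ at $u=0$. Then $\alpha\int_0^z g^{\alpha-1}(u)f'(u)\,du=z^\alpha\phi(z)$ with $\phi(z)=\alpha\int_0^1 t^{\alpha-1}\left(\frac{g(tz)}{tz}\right)^{\alpha-1}f'(tz)\,dt$ analytic near $0$, $\phi(0)=1$, and $G_\alpha(z)=z\,\phi(z)^{1/\alpha}$ with the branch of $\phi^{1/\alpha}$ equal to $1$ at $0$. "$G_\alpha$ is analytic and univalent in $\mathcal{U}$" means that the function so defined near the origin extends to an analytic and univalent function on $\mathcal{U}$. *)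

theory Defs
  imports "HOL-Complex_Analysis.Complex_Analysis"
begin

abbreviation unit_disc :: "complex set" where
  "unit_disc \<equiv> ball 0 1"

definition class_A :: "(complex \<Rightarrow> complex) set" where
  "class_A = {f. f holomorphic_on unit_disc \<and> f 0 = 0 \<and> deriv f 0 = 1}"

(* z g'(z) / g(z), with its limit value 1 (for g in class_A) at z = 0 *)
definition log_deriv_quot :: "(complex \<Rightarrow> complex) \<Rightarrow> complex \<Rightarrow> complex" where
  "log_deriv_quot g z = (if z = 0 then 1 else z * deriv g z / g z)"

(* g(u) / u, with its limit value 1 (for g in class_A) at u = 0 *)
definition quot_id :: "(complex \<Rightarrow> complex) \<Rightarrow> complex \<Rightarrow> complex" where
  "quot_id g u = (if u = 0 then 1 else g u / u)"

(* alpha * (integral from 0 to z of g(u)^(alpha-1) f'(u) du) = z^alpha * phi(z), after u = t z.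
   Near 0 the bases quot_id g (t z) and phi(z) are close to 1, so there the principal powr,
   here and in G_fun, is the analytic branch equal to 1 at 0.  Away from 0 the principal powr
   may jump, so these two functions are meaningful only as germs at 0. *)
definition phi_fun ::
    "complex \<Rightarrow> (complex \<Rightarrow> complex) \<Rightarrow> (complex \<Rightarrow> complex) \<Rightarrow> complex \<Rightarrow> complex" where
  "phi_fun \<alpha> f g z =
     \<alpha> * integral {0..1} (\<lambda>t::real. of_real t powr (\<alpha> - 1)
            * quot_id g (of_real t * z) powr (\<alpha> - 1) * deriv f (of_real t * z))"

definition G_fun ::
    "complex \<Rightarrow> (complex \<Rightarrow> complex) \<Rightarrow> (complex \<Rightarrow> complex) \<Rightarrow> complex \<Rightarrow> complex" where
  "G_fun \<alpha> f g z = z * phi_fun \<alpha> f g z powr (1 / \<alpha>)"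

definition extends_univalently :: "(complex \<Rightarrow> complex) \<Rightarrow> bool" where
  "extends_univalently G \<longleftrightarrow>
     (\<exists>F. F holomorphic_on unit_disc \<and> inj_on F unit_disc \<and> (\<forall>\<^sub>F z in nhds 0. F z = G z))"

end

theory Submission
  imports Defs
begin

text \<open>
  Write \<open>P\<close> for the branch of \<open>(g(u)/u)\<^sup>\<alpha>\<^sup>-\<^sup>1\<close> equal to 1 at 0, \<open>\<psi> = P f'\<close>, and
  \<open>\<phi>(w) = \<alpha> \<integral>\<^sub>0\<^sup>1 t\<^sup>\<alpha>\<^sup>-\<^sup>1 \<psi>(t w) dt\<close>, so that \<open>G(w) = w \<phi>(w)\<^sup>1\<^sup>/\<^sup>\<alpha>\<close>.  Put \<open>R = -(a/c) \<psi> h\<close>,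
  \<open>q = m/a\<close> and consider the family
  \<open>\<Lambda>(w,k) = w\<^sup>\<alpha> (\<phi>(w) + (k-1) R(w))\<close> for real \<open>k \<ge> 1\<close> on the disc \<open>|w| < k\<^sup>-\<^sup>1\<^sup>/\<^sup>q\<close>.
  At \<open>k = 1\<close> it is \<open>G\<^sup>\<alpha>\<close>, and with \<open>k = e\<^sup>m\<^sup>t\<close>, \<open>w = e\<^sup>-\<^sup>a\<^sup>t z\<close> it is the \<open>\<alpha>\<close>-th power of a Loewner chain.

  The third inequality of the theorem says that \<open>X = w \<Lambda>\<^sub>w / (k \<Lambda>\<^sub>k)\<close> lies in the closed disc with
  centre and radius \<open>q/2\<close> when \<open>|w| = k\<^sup>-\<^sup>1\<^sup>/\<^sup>q\<close>.  At \<open>w = 0\<close> the other two inequalities put \<open>X\<close> in the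
  open disc, so the maximum principle puts \<open>X\<close> in the open disc throughout (lemma \<open>X_disc\<close>).  Inversion
  turns this into \<open>Re (1/X) > 1/q\<close>, which means that along a level curve of \<open>\<Lambda>\<close>, as \<open>k\<close> grows, the
  quantity \<open>|w| k\<^sup>1\<^sup>/\<^sup>q\<close> strictly decreases (lemma \<open>level_curve_moves_inward\<close>).  Since \<open>\<Lambda>\<close> is affine in
  \<open>k\<close>, a level curve is the preimage of the real axis under an explicit holomorphic function, and the
  Loewner differential equation need not be solved.

  Univalence now follows by an extremal argument.  In the coordinates \<open>t = 1/k\<close>, \<open>z = w k\<^sup>1\<^sup>/\<^sup>q\<close> the parameters
  range over the compact interval \<open>[0,1]\<close>, and \<open>\<Lambda>\<close> becomes, up to a factor depending only on \<open>t\<close>,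
  \<open>z\<^sup>\<alpha> N\<^sub>t(z)\<close> with \<open>N\<^sub>0\<close> a nonzero constant.  If some \<open>N\<^sub>t\<close> had a zero, one could choose a zero
  minimising \<open>|z|\<close>; moving along the level curve \<open>\<Lambda> = 0\<close> produces a smaller one (lemma \<open>N_nonzero\<close>).
  Hence \<open>L\<^sub>t(z) = z N\<^sub>t(z)\<^sup>1\<^sup>/\<^sup>\<alpha>\<close> is well defined, and it is locally injective because \<open>X \<noteq> 0\<close>.  If \<open>L\<^sub>1\<close>
  were not injective, the triples \<open>(x,y,t)\<close> with \<open>x \<noteq> y\<close> and \<open>L\<^sub>t(x) = L\<^sub>t(y)\<close> in a fixed closed disc
  would form a nonempty compact set; take one minimising \<open>max |x| |y|\<close>.  As \<open>L\<^sub>0\<close> is linear, \<open>t > 0\<close>, and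
  both points can be moved inward along their level curves while keeping \<open>L\<^sub>t(x) = L\<^sub>t(y)\<close>, which
  contradicts minimality (theorem \<open>L_1_injective\<close>).
\<close>

section \<open>Complex logarithms and a half-plane\<close>

text \<open>
  Inversion maps the disc with centre and radius \<open>q/2\<close>, whose boundary passes through 0, to the half
  plane \<open>Re > 1/q\<close>.
\<close>

lemma disc_halfplane:
  fixes X :: complex
  assumes "norm (X - of_real (q/2)) < q/2"
  shows "0 < Re X" "X \<noteq> 0" "1/q < Re (1/X)"
proof -
  have q: "0 < q" using assms norm_ge_zero [of "X - of_real (q/2)"] by linarith
  have "(norm (X - of_real (q/2)))\<^sup>2 < (q/2)\<^sup>2"
    using assms by (intro power_strict_mono) auto
  then have *: "(Re X)\<^sup>2 + (Im X)\<^sup>2 < q * Re X"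
    unfolding cmod_power2 by (simp add: power2_eq_square field_simps)
  then have "0 < q * Re X" using sum_power2_ge_zero [of "Re X" "Im X"] by linarith
  then show Re: "0 < Re X" using q by (simp add: zero_less_mult_iff)
  then show "X \<noteq> 0" by auto
  have "0 < (Re X)\<^sup>2 + (Im X)\<^sup>2" using Re by (simp add: add_pos_nonneg)
  with * q show "1/q < Re (1/X)" by (simp add: Re_divide field_simps)
qed

lemma exp_eq_1_small:
  fixes z :: complex
  assumes "exp z = 1" "norm z < 2 * pi"
  shows "z = 0"
proof -
  have "exp z = exp 0" using assms by simp
  moreover have "\<bar>Im z - Im 0\<bar> < 2 * pi" using assms abs_Im_le_cmod [of z] by simp
  ultimately show ?thesis by (rule exp_complex_eqI [rotated])
qed

lemma ratio_notin_nonpos_Reals: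
  fixes w w0 :: complex
  assumes "w \<in> ball w0 (norm w0)"
  shows "w / w0 \<notin> \<real>\<^sub>\<le>\<^sub>0"
proof -
  have "norm (w - w0) < norm w0" using assms by (simp add: dist_norm norm_minus_commute)
  moreover from this have "w0 \<noteq> 0" by auto
  ultimately have "norm (w / w0 - 1) < 1" by (simp add: divide_simps norm_divide)
  then have "Re (w / w0) > 0" using abs_Re_le_cmod [of "w/w0 - 1"] by auto
  then show ?thesis using complex_nonpos_Reals_iff by auto
qed

lemma holomorphic_tendsto_nhds:
  assumes "f holomorphic_on S" "open S" "x \<in> S"
  shows "(f \<longlongrightarrow> f x) (nhds x)"
proof -
  have "isCont f x"
    using assms continuous_on_eq_continuous_at holomorphic_on_imp_continuous_on by blast
  then show ?thesis unfolding isCont_def tendsto_at_iff_tendsto_nhds .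
qed

text \<open>
  Near \<open>z\<close> a continuous logarithm is \<open>g z + Ln (f w / f z)\<close>, because a change of less than \<open>\<pi>\<close> in the imaginary part
  keeps the principal branch.
\<close>

lemma continuous_log_imp_holomorphic:
  fixes g :: "complex \<Rightarrow> complex"
  assumes "open S" "f holomorphic_on S" "continuous_on S g" "\<And>z. z \<in> S \<Longrightarrow> exp (g z) = f z"
    and "z \<in> S"
  shows "(g has_field_derivative deriv f z / f z) (at z)"
proof -
  have nz: "f z \<noteq> 0" using assms(4) [OF \<open>z \<in> S\<close>] by (metis exp_not_eq_zero)
  have "isCont g z" using assms continuous_on_eq_continuous_at by blast
  then obtain d where d: "d > 0" "\<And>w. dist w z < d \<Longrightarrow> dist (g w) (g z) < pi"
    unfolding continuous_at_eps_delta using pi_gt_zero by metis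
  obtain e where e: "e > 0" "ball z e \<subseteq> S" using assms openE by blast
  have eq: "g z + Ln (f w / f z) = g w" if "w \<in> ball z (min d e)" for w
  proof -
    have "w \<in> S" using that e by auto
    then have *: "f w / f z = exp (g w - g z)" using assms by (simp add: exp_diff)
    have "norm (g w - g z) < pi" using d(2) [of w] that by (simp add: dist_norm dist_commute norm_minus_commute)
    then have "\<bar>Im (g w - g z)\<bar> < pi" using abs_Im_le_cmod [of "g w - g z"] by linarith
    then show ?thesis unfolding * by (subst Ln_exp) auto
  qed
  have df: "(f has_field_derivative deriv f z) (at z)"
    using assms holomorphic_derivI by blast
  have "((\<lambda>w. g z + Ln (f w / f z)) has_field_derivative deriv f z / f z) (at z)"
    using nz by (auto intro!: derivative_eq_intros df)
  then show ?thesis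
    by (rule has_field_derivative_transform_within_open [of _ _ _ "ball z (min d e)"])
       (use d e eq in auto)
qed

section \<open>Families affine in the parameter and the maximum principle\<close>

text \<open>
  The pair \<open>(\<phi>, R)\<close> stands for the two functions \<open>w\<^sup>\<alpha> \<phi>(w)\<close> and \<open>w\<^sup>\<alpha> R(w)\<close>, which need not be
  single valued; applying \<open>w d/dw\<close> to them multiplies by \<open>w\<^sup>\<alpha>\<close> the expressions \<open>\<alpha> \<phi> + w \<phi>'\<close> and
  \<open>\<alpha> R + w R'\<close>.  The last assumption is the hypothesis on \<open>|w| = k\<^sup>-\<^sup>1\<^sup>/\<^sup>q\<close>, with \<open>1/k\<close> replaced
  by \<open>|w|\<^sup>q\<close>.
\<close>

locale loewner_pair =
  fixes \<alpha> :: complex and q :: real and \<phi> R :: "complex \<Rightarrow> complex"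
  assumes alpha_disc: "norm (\<alpha> - of_real (q/2)) < q/2"
    and hol_phi: "\<phi> holomorphic_on ball 0 1" and phi_0: "\<phi> 0 = 1"
    and hol_R: "R holomorphic_on ball 0 1"
    and R_nz: "z \<in> ball 0 1 \<Longrightarrow> R z \<noteq> 0"
    and J_disc: "z \<in> ball 0 1 \<Longrightarrow>
      norm ((\<alpha> * \<phi> z + z * deriv \<phi> z) / R z - of_real (q/2)) < q/2"
    and JB_disc: "z \<in> ball 0 1 \<Longrightarrow>
      norm (of_real (norm z powr q) * ((\<alpha> * \<phi> z + z * deriv \<phi> z) / R z)
        + of_real (1 - norm z powr q) * (\<alpha> + z * deriv R z / R z) - of_real (q/2)) \<le> q/2"
begin

text \<open>
  With \<open>t = 1/k\<close>, \<open>w = scale t * z\<close> and \<open>\<Lambda>(w,k) = w\<^sup>\<alpha> (\<phi>(w) + (k-1) R(w))\<close>: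
  the function \<open>N t z\<close> is \<open>\<Lambda>(w,k) / (k w\<^sup>\<alpha>)\<close>, and \<open>X t z\<close> is the quotient \<open>w \<Lambda>\<^sub>w / (k \<Lambda>\<^sub>k)\<close>.
  The scaling makes \<open>|z| < 1\<close> correspond to \<open>|w| < k\<^sup>-\<^sup>1\<^sup>/\<^sup>q\<close>; at \<open>t = 0\<close> it collapses the disc to
  a point, which closes the family at \<open>k = \<infinity>\<close>.
\<close>

definition J where "J z = (\<alpha> * \<phi> z + z * deriv \<phi> z) / R z"
definition B where "B z = \<alpha> + z * deriv R z / R z"
definition scale :: "real \<Rightarrow> complex" where "scale t = of_real (t powr (1/q))"
definition N :: "real \<Rightarrow> complex \<Rightarrow> complex" where
  "N t z = of_real t * \<phi> (scale t * z) + of_real (1 - t) * R (scale t * z)"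
definition X :: "real \<Rightarrow> complex \<Rightarrow> complex" where
  "X t z = of_real t * J (scale t * z) + of_real (1 - t) * B (scale t * z)"

lemma q_pos: "0 < q"
  using alpha_disc norm_ge_zero [of "\<alpha> - of_real (q/2)"] by linarith

lemma alpha_pos: "0 < Re \<alpha>" and alpha_nz: "\<alpha> \<noteq> 0"
  using disc_halfplane [OF alpha_disc] by auto

lemma hol_J: "J holomorphic_on ball 0 1" and hol_B: "B holomorphic_on ball 0 1"
  unfolding J_def B_def using R_nz by (auto intro!: holomorphic_intros hol_phi hol_R)

lemma norm_scale: "norm (scale t) = t powr (1/q)"
  by (simp add: scale_def)

lemma scale_le_1: "0 \<le> t \<Longrightarrow> t \<le> 1 \<Longrightarrow> norm (scale t) \<le> 1"
  using powr_mono2 [of "1/q" t 1] q_pos unfolding norm_scale by simp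

lemma scale_ball:
  assumes "z \<in> ball 0 1" "0 \<le> t" "t \<le> 1"
  shows "scale t * z \<in> ball 0 1"
proof -
  have "norm (scale t * z) \<le> 1 * norm z"
    unfolding norm_mult using assms by (intro mult_right_mono scale_le_1) auto
  with assms show ?thesis by simp
qed

lemma continuous_scale: "continuous_on {0..1} scale"
  unfolding scale_def using q_pos by (intro continuous_on_of_real continuous_on_powr' continuous_intros) auto

lemma J_0: "J 0 = \<alpha> / R 0" and B_0: "B 0 = \<alpha>"
  by (simp_all add: J_def B_def phi_0)

text \<open>
  On \<open>|z| = 1\<close> the bound is the last assumption of the locale, so the maximum principle gives the
  non-strict bound inside.  It is strict because at \<open>z = 0\<close> the value \<open>t J 0 + (1-t) \<alpha>\<close> is a convex
  combination of two points of the open disc.  At \<open>t = 1\<close> the function extends only to the open unit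
  disc, but there it is \<open>J\<close>.
\<close>

lemma X_disc:
  assumes z: "z \<in> ball 0 1" and t: "0 \<le> t" "t \<le> 1"
  shows "norm (X t z - of_real (q/2)) < q/2"
proof (cases "t = 1")
  case True
  then have "X t z = J (scale t * z)" by (simp add: X_def)
  then show ?thesis using J_disc [OF scale_ball [OF assms]] by (simp add: J_def)
next
  case False
  then have t1: "t < 1" using t by simp
  define s where "s = t powr (1/q)"
  have s: "0 \<le> s" "s < 1" using t t1 q_pos powr_less_mono2 [of "1/q" t 1]
    by (auto simp: s_def)
  have ss: "scale t = of_real s" by (simp add: scale_def s_def)
  have sq: "s powr q = t" using t q_pos by (simp add: s_def powr_powr)
  have in_ball: "of_real s * w \<in> ball 0 1" if "w \<in> cball 0 1" for w :: complex
  proof -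
    have "s * norm w \<le> s * 1" using that s by (intro mult_left_mono) auto
    with s show ?thesis by (simp add: norm_mult)
  qed
  define Y where "Y w = X t w - of_real (q/2)" for w
  have sub: "(\<lambda>w::complex. of_real s * w) ` cball 0 1 \<subseteq> ball 0 1" using in_ball by blast
  have holc: "(\<lambda>w. F (of_real s * w)) holomorphic_on cball 0 1"
    if "F holomorphic_on ball 0 1" for F :: "complex \<Rightarrow> complex"
    using holomorphic_on_compose_gen [of "\<lambda>w. of_real s * w" "cball 0 1" F "ball 0 1"] that sub
    by (auto simp: o_def intro!: holomorphic_intros)
  have holY: "Y holomorphic_on cball 0 1"
    unfolding Y_def X_def ss by (intro holomorphic_intros holc hol_J hol_B)
  have contY: "continuous_on (cball 0 1) Y" using holY holomorphic_on_imp_continuous_on by blast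
  have front: "norm (Y w) \<le> q/2" if "w \<in> sphere 0 1" for w
  proof -
    have "of_real s * w \<in> ball 0 1" using in_ball that by auto
    moreover have "norm (of_real s * w) powr q = t"
      using that sq s by (simp add: norm_mult)
    ultimately show ?thesis
      using JB_disc [of "of_real s * w"] by (simp add: Y_def X_def J_def B_def ss)
  qed
  have le: "norm (Y w) \<le> q/2" if "w \<in> ball 0 1" for w
  proof (rule maximum_modulus_frontier [of Y "ball 0 1"])
    show "Y holomorphic_on interior (ball 0 1)" using holY by (auto intro: holomorphic_on_subset)
  qed (use contY front that in auto)
  have "norm (Y 0) < q/2"
  proof -
    have "Y 0 = t *\<^sub>R (J 0 - of_real (q/2)) + (1 - t) *\<^sub>R (\<alpha> - of_real (q/2))"
      by (simp add: Y_def X_def B_0 scaleR_conv_of_real algebra_simps) (simp add: field_simps)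
    moreover have "t *\<^sub>R (J 0 - of_real (q/2)) + (1 - t) *\<^sub>R (\<alpha> - of_real (q/2)) \<in> ball 0 (q/2)"
      by (rule convexD) (use J_disc [of 0] alpha_disc t in \<open>auto simp: J_def\<close>)
    ultimately show ?thesis by simp
  qed
  moreover have False if eq: "norm (Y z) = q/2"
  proof -
    have "Y constant_on ball 0 1"
      by (rule maximum_modulus_principle [of Y _ "ball 0 1" z])
         (use holY z le eq in \<open>auto intro: holomorphic_on_subset\<close>)
    then have "Y z = Y 0" using z unfolding constant_on_def by force
    with eq \<open>norm (Y 0) < q/2\<close> show False by simp
  qed
  ultimately show ?thesis using le [OF z] unfolding Y_def by force
qed

lemma continuous_comp_scale:
  assumes "continuous_on (ball 0 1) F"
  shows "continuous_on (ball 0 1 \<times> {0..1}) (\<lambda>(z, t). F (scale t * z))"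
proof -
  have "continuous_on (ball 0 1 \<times> {0..1}) (\<lambda>p. scale (snd p) * fst p)"
    by (intro continuous_intros continuous_on_compose2 [OF continuous_scale]) auto
  then have "continuous_on (ball 0 1 \<times> {0..1}) (\<lambda>p. F (scale (snd p) * fst p))"
    by (rule continuous_on_compose2 [OF assms]) (auto intro: scale_ball simp del: mem_ball)
  then show ?thesis by (simp add: case_prod_unfold)
qed

lemma continuous_N: "continuous_on (ball 0 1 \<times> {0..1}) (\<lambda>(z, t). N t z)"
  and continuous_X: "continuous_on (ball 0 1 \<times> {0..1}) (\<lambda>(z, t). X t z)"
  unfolding N_def X_def case_prod_unfold
  by (intro continuous_intros continuous_comp_scale [unfolded case_prod_unfold]
      holomorphic_on_imp_continuous_on hol_phi hol_R hol_J hol_B)+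

lemma hol_N:
  assumes "0 \<le> t" "t \<le> 1"
  shows "N t holomorphic_on ball 0 1"
proof -
  have sub: "(\<lambda>w. scale t * w) ` ball 0 1 \<subseteq> ball 0 1" using assms scale_ball by blast
  have holc: "(\<lambda>w. F (scale t * w)) holomorphic_on ball 0 1"
    if "F holomorphic_on ball 0 1" for F :: "complex \<Rightarrow> complex"
    using holomorphic_on_compose_gen [of "\<lambda>w. scale t * w" "ball 0 1" F "ball 0 1"] that sub
    by (auto simp: o_def intro!: holomorphic_intros)
  then show ?thesis unfolding N_def [abs_def] by (intro holomorphic_intros holc hol_phi hol_R)
qed

text \<open>
  This is \<open>w \<Lambda>\<^sub>w = X k \<Lambda>\<^sub>k\<close>, divided by \<open>k w\<^sup>\<alpha>\<close>.
\<close>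

lemma N_deriv:
  assumes "z \<in> ball 0 1" "0 \<le> t" "t \<le> 1"
  shows "\<alpha> * N t z + z * deriv (N t) z = R (scale t * z) * X t z"
proof -
  define w where "w = scale t * z"
  have w: "w \<in> ball 0 1" using assms scale_ball by (simp add: w_def del: mem_ball)
  have alg: "of_real t * (\<alpha> * a + w * b) + of_real (1 - t) * (\<alpha> * c + w * e) =
      \<alpha> * (of_real t * a + of_real (1 - t) * c)
      + z * (of_real t * (b * scale t) + of_real (1 - t) * (e * scale t))" for a b c e
    by (simp add: w_def algebra_simps)
  have chain: "((\<lambda>w. F (scale t * w)) has_field_derivative deriv F w * scale t) (at z)"
    if "F holomorphic_on ball 0 1" for F :: "complex \<Rightarrow> complex"
  proof -
    have "(F has_field_derivative deriv F w) (at w)"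
      using that w holomorphic_derivI by blast
    moreover have "((\<lambda>w. scale t * w) has_field_derivative scale t) (at z)"
      by (auto intro!: derivative_eq_intros)
    ultimately show ?thesis using DERIV_chain2 unfolding w_def by blast
  qed
  have "(N t has_field_derivative
     of_real t * (deriv \<phi> w * scale t) + of_real (1 - t) * (deriv R w * scale t)) (at z)"
    unfolding N_def [abs_def] by (intro derivative_intros DERIV_cmult chain hol_phi hol_R)
  then have d: "deriv (N t) z =
     of_real t * (deriv \<phi> w * scale t) + of_real (1 - t) * (deriv R w * scale t)"
    by (rule DERIV_imp_deriv)
  have RJ: "R w * J w = \<alpha> * \<phi> w + w * deriv \<phi> w" and RB: "R w * B w = \<alpha> * R w + w * deriv R w"
    using R_nz [OF w] by (simp_all add: J_def B_def field_simps)
  have "R w * X t z = of_real t * (R w * J w) + of_real (1 - t) * (R w * B w)"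
    unfolding X_def w_def by (simp only: algebra_simps)
  also have "\<dots> = \<alpha> * N t z + z * deriv (N t) z"
    unfolding RJ RB d N_def w_def [symmetric] by (rule alg)
  finally show ?thesis by (simp add: w_def)
qed


section \<open>Level curves move inward\<close>

text \<open>
  Let \<open>C\<close> be the value at \<open>(w0, k0)\<close>.  Solving \<open>(w/w0)\<^sup>\<alpha> (\<phi>(w) + (k-1) R(w)) = C\<close> for \<open>k\<close> gives a
  holomorphic function \<open>K(w)\<close> near \<open>w0\<close> with \<open>K(w0) = k0\<close> and \<open>w0 K'(w0) = - k0 X\<close>.  Its local inverse
  \<open>g\<close> therefore satisfies \<open>g'(k0)/w0 = - 1/(k0 X)\<close>, and
  \<open>d/dk (ln |g(k)| + (1/q) ln k) = (1/q - Re (1/X)) / k0 < 0\<close> at \<open>k = k0\<close>.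
\<close>

lemma level_curve_moves_inward:
  assumes w0: "w0 \<in> ball 0 1" "w0 \<noteq> 0" and k0: "1 \<le> k0" "norm w0 * k0 powr (1/q) < 1"
    and \<delta>: "\<delta> > 0"
  obtains \<epsilon> where "\<epsilon> > 0"
    "\<And>k. k0 < k \<Longrightarrow> k < k0 + \<epsilon> \<Longrightarrow> \<exists>w. norm (w - w0) < \<delta> \<and>
       norm w * k powr (1/q) < norm w0 * k0 powr (1/q) \<and>
       exp (\<alpha> * Ln (w / w0)) * (\<phi> w + of_real (k - 1) * R w) = \<phi> w0 + of_real (k0 - 1) * R w0"
proof -
  define C where "C = \<phi> w0 + of_real (k0 - 1) * R w0"
  define z0 where "z0 = w0 * of_real (k0 powr (1/q))"
  define X0 where "X0 = X (1/k0) z0"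
  have sc: "scale (1/k0) * z0 = w0"
    using k0 by (simp add: scale_def z0_def powr_divide flip: of_real_mult)
  have "norm (X0 - of_real (q/2)) < q/2"
    unfolding X0_def using k0 by (intro X_disc) (auto simp: z0_def norm_mult)
  note X0 = disc_halfplane [OF this]
  \<comment> \<open>This radius keeps the ball inside the unit disc and \<open>w / w0\<close> off the branch cut of the logarithm.\<close>
  define \<eta> where "\<eta> = min \<delta> (min (norm w0) (1 - norm w0))"
  have \<eta>: "\<eta> > 0" using \<delta> w0 by (simp add: \<eta>_def)
  define S where "S = ball w0 \<eta>"
  have S: "open S" "w0 \<in> S" using \<eta> by (auto simp: S_def)
  have SU: "S \<subseteq> ball 0 1"
  proof
    fix w assume "w \<in> S"
    then have "norm (w - w0) < 1 - norm w0" by (simp add: S_def \<eta>_def dist_norm norm_minus_commute)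
    then show "w \<in> ball 0 1" using norm_triangle_ineq2 [of w w0] by simp
  qed
  have slit: "w / w0 \<notin> \<real>\<^sub>\<le>\<^sub>0" if "w \<in> S" for w
    by (rule ratio_notin_nonpos_Reals) (use that in \<open>auto simp: S_def \<eta>_def\<close>)
  have RS: "R w \<noteq> 0" if "w \<in> S" for w using that SU R_nz by auto
  have holS: "\<phi> holomorphic_on S" "R holomorphic_on S"
    using hol_phi hol_R SU holomorphic_on_subset by auto
  define K where "K w = 1 + (C * exp (- \<alpha> * Ln (w / w0)) - \<phi> w) / R w" for w
  have holK: "K holomorphic_on S"
    unfolding K_def using slit RS w0 by (auto intro!: holomorphic_intros holS)
  have K0: "K w0 = of_real k0" using w0 R_nz [OF w0(1)] by (simp add: K_def C_def)
  have dphi: "(\<phi> has_field_derivative deriv \<phi> w0) (at w0)"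
    and dR: "(R has_field_derivative deriv R w0) (at w0)"
    using holS S holomorphic_derivI by blast+
  have Rw0: "R w0 \<noteq> 0" using R_nz [OF w0(1)] .
  have kX: "of_real k0 * X0 * R w0 =
      (\<alpha> * \<phi> w0 + w0 * deriv \<phi> w0) + of_real (k0 - 1) * (\<alpha> * R w0 + w0 * deriv R w0)"
    unfolding X0_def X_def sc J_def B_def using k0 Rw0 by (simp add: field_simps)
  have "(K has_field_derivative
      ((C * (- \<alpha> / w0) - deriv \<phi> w0) * R w0 - (C - \<phi> w0) * deriv R w0) / (R w0 * R w0)) (at w0)"
    unfolding K_def using w0 Rw0
    by (auto intro!: derivative_eq_intros dphi dR simp: field_simps)
  also have "((C * (- \<alpha> / w0) - deriv \<phi> w0) * R w0 - (C - \<phi> w0) * deriv R w0) / (R w0 * R w0)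
      = - (of_real k0 * X0 * R w0) / (w0 * R w0)"
    unfolding kX C_def using w0 Rw0 by (simp add: field_simps)
  also have "\<dots> = - of_real k0 * X0 / w0" using Rw0 by simp
  finally have dK: "deriv K w0 = - of_real k0 * X0 / w0" by (rule DERIV_imp_deriv)
  then have "deriv K w0 \<noteq> 0" using k0 X0 w0 by simp
  then obtain r where r: "r > 0" "ball w0 r \<subseteq> S" "inj_on K (ball w0 r)"
    using has_complex_derivative_locally_injective [OF holK S(2,1)] by blast
  have holK': "K holomorphic_on ball w0 r" using holK r holomorphic_on_subset by blast
  obtain g where g: "g holomorphic_on K ` ball w0 r"
      "\<And>z. z \<in> ball w0 r \<Longrightarrow> deriv K z * deriv g (K z) = 1"
      "\<And>z. z \<in> ball w0 r \<Longrightarrow> g (K z) = z"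
    using holomorphic_has_inverse [OF holK' open_ball r(3)] by blast
  have op: "open (K ` ball w0 r)" using open_mapping_thm3 [OF holK' open_ball r(3)] .
  have mem: "of_real k0 \<in> K ` ball w0 r" using K0 r by (metis centre_in_ball imageI)
  have gk0: "g (of_real k0) = w0" using g(3) [of w0] K0 r by simp
  have dg: "(g has_field_derivative - w0 / (of_real k0 * X0)) (at (of_real k0))"
  proof -
    have "deriv g (of_real k0) = - w0 / (of_real k0 * X0)"
      using g(2) [of w0] K0 r k0 X0 w0 by (simp add: dK divide_simps) (simp add: algebra_simps minus_equation_iff)
    then show ?thesis using holomorphic_derivI [OF g(1) op mem] by simp
  qed
  define v where "v t = Re (Ln (g (of_real t) / w0)) + (1/q) * ln t" for t
  have "((\<lambda>c. Ln (g c / w0)) has_field_derivative - 1 / (of_real k0 * X0)) (at (of_real k0))"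
    using w0 gk0 by (auto intro!: derivative_eq_intros dg)
  from has_vector_derivative_real_field [OF this]
  have "((\<lambda>t. Re (Ln (g (of_real t) / w0))) has_field_derivative Re (- 1 / (of_real k0 * X0))) (at k0)"
    by (rule has_field_derivative_Re)
  then have "(v has_field_derivative Re (- 1 / (of_real k0 * X0)) + (1/q) * (1 / k0)) (at k0)"
    unfolding v_def using k0
    by (intro DERIV_add DERIV_cmult) (auto intro!: derivative_eq_intros)
  moreover have "Re (- 1 / (of_real k0 * X0)) + (1/q) * (1 / k0) < 0"
  proof -
    have "- 1 / (of_real k0 * X0) = of_real (- 1 / k0) * (1 / X0)" by simp
    then have "Re (- 1 / (of_real k0 * X0)) = - Re (1 / X0) / k0"
      by (simp only: Re_complex_of_real Im_complex_of_real times_complex.sel) simp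
    moreover have "(1/q) / k0 < Re (1 / X0) / k0"
      using X0(3) k0 by (intro divide_strict_right_mono) auto
    ultimately show ?thesis by simp
  qed
  ultimately obtain d where d: "d > 0" "\<And>h. 0 < h \<Longrightarrow> h < d \<Longrightarrow> v (k0 + h) < v k0"
    using DERIV_neg_dec_right by blast
  obtain e where e: "e > 0" "ball (of_real k0) e \<subseteq> K ` ball w0 r"
    using op mem openE by blast
  show ?thesis
  proof (rule that [of "min d e"])
    show "min d e > 0" using d e by simp
    fix k assume k: "k0 < k" "k < k0 + min d e"
    have "of_real k \<in> ball (of_real k0 :: complex) e"
      using k by (simp add: dist_norm flip: of_real_diff)
    with e obtain w where w: "w \<in> ball w0 r" "of_real k = K w" by blast
    have gw: "g (of_real k) = w" using g(3) w by simp
    have wS: "w \<in> S" using w r by blast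
    have wz: "w \<noteq> 0" using slit [OF wS] by auto
    have "v k < v k0" using d(2) [of "k - k0"] k by simp
    then have "ln (norm (w / w0)) + (1/q) * ln k < (1/q) * ln k0"
      using gw gk0 w0 wz by (simp add: v_def)
    then have "exp (ln (norm (w / w0)) + (1/q) * ln k) < exp ((1/q) * ln k0)"
      by simp
    then have 1: "norm w * k powr (1/q) < norm w0 * k0 powr (1/q)"
      using k k0 w0 wz by (simp add: exp_add norm_divide powr_def field_simps)
    have "of_real (k - 1) * R w = C * exp (- \<alpha> * Ln (w / w0)) - \<phi> w"
      using w(2) RS [OF wS] by (simp add: K_def field_simps)
    then have "exp (\<alpha> * Ln (w / w0)) * (\<phi> w + of_real (k - 1) * R w)
        = C * (exp (\<alpha> * Ln (w / w0)) * exp (- \<alpha> * Ln (w / w0)))"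
      by simp
    also have "\<dots> = C" by (simp flip: exp_add)
    finally have "exp (\<alpha> * Ln (w / w0)) * (\<phi> w + of_real (k - 1) * R w) = C" .
    moreover have "norm (w - w0) < \<delta>"
      using wS by (simp add: S_def \<eta>_def dist_norm norm_minus_commute)
    ultimately show "\<exists>w. norm (w - w0) < \<delta> \<and>
       norm w * k powr (1/q) < norm w0 * k0 powr (1/q) \<and>
       exp (\<alpha> * Ln (w / w0)) * (\<phi> w + of_real (k - 1) * R w) = \<phi> w0 + of_real (k0 - 1) * R w0"
      using 1 unfolding C_def by blast
  qed
qed

text \<open>
  A zero of \<open>N t\<close> with \<open>t > 0\<close> corresponds to a point \<open>w\<close> at which \<open>K(w) = 1 - \<phi>(w)/R(w)\<close> is the real
  number \<open>k = 1/t \<ge> 1\<close>.  The points of this kind with \<open>|w| k\<^sup>1\<^sup>/\<^sup>q\<close> bounded by a given \<open>r < 1\<close> form a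
  compact set, and on it that quantity would have a minimum, which moving along the level curve of
  value 0 lowers.
\<close>

lemma N_nonzero:
  assumes "z \<in> ball 0 1" "0 \<le> t" "t \<le> 1"
  shows "N t z \<noteq> 0"
proof (cases "t = 0")
  case True
  then show ?thesis using R_nz [of 0] q_pos by (simp add: N_def scale_def)
next
  case False
  then have t: "0 < t" "t \<le> 1" using assms by auto
  define K where "K w = 1 - \<phi> w / R w" for w
  have contK: "continuous_on (ball 0 1) K"
    unfolding K_def using R_nz by (intro continuous_intros holomorphic_on_imp_continuous_on hol_phi hol_R) auto
  define w1 where "w1 = scale t * z"
  define r where "r = norm w1 * (1/t) powr (1/q)"
  have r: "0 \<le> r" "r < 1"
    using assms t by (auto simp: r_def w1_def norm_mult norm_scale powr_divide)
  show ?thesis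
  proof
    assume N0: "N t z = 0"
    define Z where "Z = {w \<in> cball 0 r. Im (K w) = 0 \<and> 1 \<le> Re (K w) \<and>
                           norm w * (Re (K w)) powr (1/q) \<le> r}"
    have sub: "cball 0 r \<subseteq> (ball 0 1 :: complex set)" using r by auto
    have cK: "continuous_on (cball 0 r) K" using contK sub continuous_on_subset by blast
    have cm: "continuous_on Z (\<lambda>w. norm w * (Re (K w)) powr (1/q))"
      by (intro continuous_intros continuous_on_subset [OF cK]) (auto simp: Z_def)
    have "compact Z"
    proof -
      define Y where "Y = {w \<in> cball 0 r. Im (K w) = 0 \<and> 1 \<le> Re (K w)}"
      have "Y = cball 0 r \<inter> K -` ({c. Im c = 0} \<inter> {c. 1 \<le> Re c})" by (auto simp: Y_def)
      moreover have "closed ({c. Im c = 0} \<inter> {c. 1 \<le> Re c})"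
        by (intro closed_Int closed_Collect_eq closed_Collect_le continuous_intros)
      ultimately have "closed Y" using continuous_on_closed_vimage [of "cball 0 r" K] cK
        by (metis Int_commute closed_cball)
      have cY: "continuous_on Y (\<lambda>w. norm w * (Re (K w)) powr (1/q))"
        by (intro continuous_intros continuous_on_subset [OF cK]) (auto simp: Y_def)
      have "Z = Y \<inter> (\<lambda>w. norm w * (Re (K w)) powr (1/q)) -` {..r}" by (auto simp: Z_def Y_def)
      then have "closed Z" using continuous_on_closed_vimage [OF \<open>closed Y\<close>] cY
        by (metis Int_commute closed_atMost)
      moreover have "bounded Z" by (rule bounded_subset [of "cball 0 r"]) (auto simp: Z_def)
      ultimately show ?thesis using compact_eq_bounded_closed by blast
    qed
    moreover have "w1 \<in> Z"
    proof -
      have w1: "w1 \<in> ball 0 1" using scale_ball [of z t] assms by (simp add: w1_def)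
      have "of_real t * (K w1) = 1"
        using N0 R_nz [OF w1] by (simp add: N_def K_def w1_def field_simps)
      then have "K w1 = of_real (1/t)" using t by (simp add: field_simps)
      moreover have "norm w1 \<le> r"
        unfolding r_def using t ge_one_powr_ge_zero [of "1/t" "1/q"] q_pos
        by (intro mult_right_le_one_le [THEN order_trans] mult_le_cancel_left1 [THEN iffD2]) auto
      ultimately show ?thesis using t by (simp add: Z_def r_def)
    qed
    ultimately obtain w0 where w0: "w0 \<in> Z"
      and min: "\<And>w. w \<in> Z \<Longrightarrow> norm w0 * (Re (K w0)) powr (1/q) \<le> norm w * (Re (K w)) powr (1/q)"
      using continuous_attains_inf [OF _ _ cm] by blast
    define k0 where "k0 = Re (K w0)"
    have Kw0: "K w0 = of_real k0" "1 \<le> k0" "norm w0 * k0 powr (1/q) \<le> r"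
      using w0 by (auto simp: Z_def k0_def complex_eq_iff)
    have w0U: "w0 \<in> ball 0 1" using w0 sub by (auto simp: Z_def)
    \<comment> \<open>At the origin \<open>K = 1 - J 0 / \<alpha>\<close>; both \<open>J 0\<close> and \<open>\<alpha>\<close> lie in the right half plane, so
      \<open>J 0 / \<alpha>\<close> is not a nonpositive real.\<close>
    have "w0 \<noteq> 0"
    proof
      assume "w0 = 0"
      then have "1 - J 0 / \<alpha> = of_real k0" using Kw0 alpha_nz by (simp add: K_def J_0 phi_0)
      then have "J 0 = of_real (1 - k0) * \<alpha>" using alpha_nz by (simp add: field_simps)
      then have "Re (J 0) = (1 - k0) * Re \<alpha>" by simp
      moreover have "0 < Re (J 0)"
        using disc_halfplane(1) [OF J_disc [of 0]] by (simp add: J_def)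
      ultimately show False using alpha_pos Kw0(2) by (simp add: zero_less_mult_iff)
    qed
    have "norm w0 * k0 powr (1/q) < 1" using Kw0(3) r by simp
    from level_curve_moves_inward [OF w0U \<open>w0 \<noteq> 0\<close> Kw0(2) this zero_less_one]
    obtain \<epsilon> where \<epsilon>: "\<epsilon> > 0" "\<And>k. k0 < k \<Longrightarrow> k < k0 + \<epsilon> \<Longrightarrow> \<exists>w. norm (w - w0) < 1 \<and>
       norm w * k powr (1/q) < norm w0 * k0 powr (1/q) \<and>
       exp (\<alpha> * Ln (w / w0)) * (\<phi> w + of_real (k - 1) * R w) = \<phi> w0 + of_real (k0 - 1) * R w0"
      by metis
    define k where "k = k0 + \<epsilon>/2"
    have k: "k0 < k" "k < k0 + \<epsilon>" using \<epsilon> by (auto simp: k_def)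
    obtain w where w: "norm w * k powr (1/q) < norm w0 * k0 powr (1/q)"
       "exp (\<alpha> * Ln (w / w0)) * (\<phi> w + of_real (k - 1) * R w) = \<phi> w0 + of_real (k0 - 1) * R w0"
      using \<epsilon>(2) [OF k] by blast
    have "\<phi> w0 + of_real (k0 - 1) * R w0 = 0"
      using Kw0(1) R_nz [OF w0U] by (simp add: K_def field_simps)
    then have z: "\<phi> w + of_real (k - 1) * R w = 0" using w(2) by simp
    \<comment> \<open>The smaller zero stays in the compact set because \<open>|w| \<le> |w| k\<^sup>1\<^sup>/\<^sup>q\<close>.\<close>
    have "norm w \<le> norm w * k powr (1/q)"
      using ge_one_powr_ge_zero [of k "1/q"] q_pos k Kw0(2)
      by (intro mult_le_cancel_left1 [THEN iffD2]) auto
    then have wr: "norm w \<le> r" using w(1) Kw0(3) by linarith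
    then have "R w \<noteq> 0" using R_nz [of w] r by simp
    then have "K w = of_real k" using z by (simp add: K_def field_simps)
    then have "w \<in> Z" using wr w(1) Kw0 k by (simp add: Z_def)
    from min [OF this] w(1) \<open>K w = of_real k\<close> show False by (simp add: k0_def)
  qed
qed

end

section \<open>Injectivity of the chain\<close>

text \<open>
  A logarithm of \<open>N\<close>, jointly continuous in \<open>z\<close> and \<open>t\<close>, makes the root \<open>z N\<^sub>t(z)\<^sup>1\<^sup>/\<^sup>\<alpha>\<close> single valued
  consistently along the whole family.
\<close>

locale loewner_log = loewner_pair +
  fixes l :: "real \<Rightarrow> complex \<Rightarrow> complex"
  assumes cont_l: "continuous_on (ball 0 1 \<times> {0..1}) (\<lambda>(z, t). l t z)"
    and exp_l: "\<lbrakk>z \<in> ball 0 1; 0 \<le> t; t \<le> 1\<rbrakk> \<Longrightarrow> exp (l t z) = N t z"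
begin

definition L where "L t z = z * exp (l t z / \<alpha>)"

lemma l_deriv:
  assumes "z \<in> ball 0 1" "0 \<le> t" "t \<le> 1"
  shows "(l t has_field_derivative deriv (N t) z / N t z) (at z)"
proof (rule continuous_log_imp_holomorphic [OF open_ball hol_N _ exp_l])
  have "continuous_on (ball 0 1) (\<lambda>z. (\<lambda>(z, t). l t z) (z, t))"
    by (rule continuous_on_compose2 [OF cont_l]) (use assms in \<open>auto intro!: continuous_intros\<close>)
  then show "continuous_on (ball 0 1) (l t)" by simp
qed (use assms in auto)

lemma L_deriv:
  assumes "z \<in> ball 0 1" "0 \<le> t" "t \<le> 1"
  shows "(L t has_field_derivative
    exp (l t z / \<alpha>) * (R (scale t * z) * X t z) / (\<alpha> * N t z)) (at z)"
proof -
  have nz: "N t z \<noteq> 0" using N_nonzero assms .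
  have "(L t has_field_derivative
     exp (l t z / \<alpha>) + z * (exp (l t z / \<alpha>) * (deriv (N t) z / N t z / \<alpha>))) (at z)"
    unfolding L_def [abs_def] using alpha_nz
    by (auto intro!: derivative_eq_intros l_deriv assms)
  also have "exp (l t z / \<alpha>) + z * (exp (l t z / \<alpha>) * (deriv (N t) z / N t z / \<alpha>))
     = exp (l t z / \<alpha>) * (\<alpha> * N t z + z * deriv (N t) z) / (\<alpha> * N t z)"
    using nz alpha_nz by (simp add: field_simps)
  finally show ?thesis unfolding N_deriv [OF assms] .
qed

lemma continuous_L: "continuous_on (ball 0 1 \<times> {0..1}) (\<lambda>(z, t). L t z)"
  using cont_l alpha_nz unfolding L_def case_prod_unfold by (auto intro!: continuous_intros)

text \<open>
  By \<open>L_deriv\<close> the derivative is continuous in \<open>(z, t)\<close>, and it is nonzero at \<open>(z0, t0)\<close> because \<open>X\<close> is.  Near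
  that point \<open>L t z - d z\<close>, where \<open>d\<close> is the derivative at \<open>(z0, t0)\<close>, has Lipschitz constant \<open>|d|/2\<close>, which
  forces injectivity on a ball that does not depend on \<open>t\<close>.
\<close>

lemma L_locally_injective:
  assumes z0: "z0 \<in> ball 0 1" and t0: "0 \<le> t0" "t0 \<le> 1"
  obtains e where "e > 0" "ball z0 e \<subseteq> ball 0 1"
    "\<And>t. \<lbrakk>0 \<le> t; t \<le> 1; \<bar>t - t0\<bar> < e\<rbrakk> \<Longrightarrow> inj_on (L t) (ball z0 e)"
proof -
  define D where "D z t = exp (l t z / \<alpha>) * (R (scale t * z) * X t z) / (\<alpha> * N t z)" for z t
  define d where "d = D z0 t0"
  have "R (scale t0 * z0) \<noteq> 0" "X t0 z0 \<noteq> 0" "N t0 z0 \<noteq> 0"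
    using R_nz scale_ball N_nonzero disc_halfplane [OF X_disc] assms by (auto simp del: mem_ball)
  then have d: "d \<noteq> 0" using alpha_nz by (simp add: d_def D_def)
  have "continuous_on (ball 0 1 \<times> {0..1}) (\<lambda>(z, t). D z t)"
    unfolding D_def case_prod_unfold
    using cont_l continuous_N continuous_X alpha_nz N_nonzero
      continuous_comp_scale [OF holomorphic_on_imp_continuous_on [OF hol_R]]
    unfolding case_prod_unfold
    by (intro continuous_intros) (auto simp del: mem_ball)
  then have contD: "continuous_on (ball 0 1 \<times> {0..1}) (\<lambda>u. D (fst u) (snd u))"
    by (simp add: case_prod_unfold)
  have "(z0, t0) \<in> ball 0 1 \<times> {0..1}" "norm d / 2 > 0" using assms d by auto
  then obtain e1 where e1: "e1 > 0" "\<And>u. u \<in> ball 0 1 \<times> {0..1} \<Longrightarrow>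
      dist u (z0, t0) < e1 \<Longrightarrow> dist (D (fst u) (snd u)) (D (fst (z0, t0)) (snd (z0, t0))) < norm d / 2"
    using contD unfolding continuous_on_iff by blast
  have e1': "\<And>z t. z \<in> ball 0 1 \<Longrightarrow> 0 \<le> t \<Longrightarrow> t \<le> 1 \<Longrightarrow> dist (z, t) (z0, t0) < e1
        \<Longrightarrow> dist (D z t) d < norm d / 2"
    using e1(2) by (auto simp: d_def)
  obtain e2 where e2: "e2 > 0" "ball z0 e2 \<subseteq> ball 0 1"
    using z0 openE [OF open_ball] by blast
  define e where "e = min (e1/2) e2"
  have e: "e > 0" "e \<le> e1/2" "e \<le> e2" using e1 e2 by (auto simp: e_def)
  have sub: "ball z0 e \<subseteq> ball 0 1" using e2 e by auto
  show ?thesis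
  proof (rule that [of e])
    fix t assume t: "0 \<le> t" "t \<le> 1" "\<bar>t - t0\<bar> < e"
    show "inj_on (L t) (ball z0 e)"
    proof (rule inj_onI, rule ccontr)
      fix x y assume xy: "x \<in> ball z0 e" "y \<in> ball z0 e" "L t x = L t y" "x \<noteq> y"
      have "norm ((L t x - d * x) - (L t y - d * y)) \<le> norm d / 2 * norm (x - y)"
      proof (rule field_differentiable_bound [OF convex_ball [of z0 e] _ _ xy(1,2)])
        fix z assume z: "z \<in> ball z0 e"
        then have zb: "z \<in> ball 0 1" using sub by blast
        have "(L t has_field_derivative D z t) (at z)"
          unfolding D_def using L_deriv [OF zb t(1,2)] .
        then have "((\<lambda>z. L t z - d * z) has_field_derivative D z t - d * 1) (at z)"
          by (intro DERIV_diff DERIV_cmult DERIV_ident)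
        then show "((\<lambda>z. L t z - d * z) has_field_derivative D z t - d) (at z within ball z0 e)"
          by (simp add: has_field_derivative_at_within)
        have "dist (z, t) (z0, t0) \<le> dist z z0 + dist t t0"
          unfolding dist_Pair_Pair by (rule sqrt_sum_squares_le_sum) auto
        also have "\<dots> < e1" using z t e by (simp add: dist_commute dist_real_def)
        finally show "norm (D z t - d) \<le> norm d / 2"
          using e1' [OF zb t(1,2)] by (simp add: dist_norm)
      qed
      also have "(L t x - d * x) - (L t y - d * y) = - d * (x - y)"
        using xy by (simp add: algebra_simps)
      finally show False using d xy(4) by (simp add: norm_mult)
    qed
  qed (use e sub in auto)
qed

text \<open>
  The level curve through \<open>z0\<close>, expressed in terms of \<open>L\<close>.  The factor in front of \<open>L (1/k0) z0\<close> does not depend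
  on \<open>z0\<close>: two points with the same value of \<open>L\<close> keep equal values when both are moved.  The level
  curve only controls \<open>\<alpha>\<close>-th powers, hence determines the logarithm up to a multiple of \<open>2\<pi>i\<close>;
  the quantity \<open>D\<close> in the proof is that multiple, and it vanishes by continuity.
\<close>

lemma L_moves_inward:
  assumes z0: "z0 \<in> ball 0 1" "z0 \<noteq> 0" and k0: "1 \<le> k0" and \<delta>: "\<delta> > 0"
  obtains \<epsilon> where "\<epsilon> > 0"
    "\<And>k. k0 < k \<Longrightarrow> k < k0 + \<epsilon> \<Longrightarrow> \<exists>z. norm (z - z0) < \<delta> \<and> norm z < norm z0 \<and>
       L (1/k) z = of_real ((k/k0) powr (1/q)) * exp (- of_real (ln (k/k0)) / \<alpha>) * L (1/k0) z0"
proof -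
  define p where "p = 1/q"
  define w0 where "w0 = scale (1/k0) * z0"
  have scz: "scale (1/k) * (w * of_real (k powr p)) = w" if "k \<ge> 1" for k w
    using that by (simp add: scale_def p_def powr_divide flip: of_real_mult)
  have z0w: "w0 * of_real (k0 powr p) = z0"
    using k0 by (simp add: w0_def scale_def p_def powr_divide flip: of_real_mult)
  have w0: "w0 \<in> ball 0 1" "w0 \<noteq> 0"
    using scale_ball [of z0 "1/k0"] z0 k0 z0w by (auto simp: w0_def simp del: mem_ball)
  have nw0: "norm w0 * k0 powr p = norm z0" by (simp flip: z0w add: norm_mult)
  have H: "of_real k * N (1/k) (w * of_real (k powr p)) = \<phi> w + of_real (k - 1) * R w"
    if "k \<ge> 1" for k w
    unfolding N_def scz [OF that] using that by (simp add: field_simps)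
  define A where "A = {(w, k). w \<in> ball w0 (norm w0) \<and> 1 \<le> k \<and> w * of_real (k powr p) \<in> ball 0 1}"
  define D where "D w k = \<alpha> * Ln (w / w0) + l (1/k) (w * of_real (k powr p)) - l (1/k0) z0
      + of_real (ln (k / k0))" for w k
  note slit = ratio_notin_nonpos_Reals
  have 1: "continuous_on A (\<lambda>x. fst x * of_real (snd x powr p))"
    by (intro continuous_intros) (auto simp: A_def)
  have "continuous_on A (\<lambda>x. (\<lambda>(z, t). l t z) (fst x * of_real (snd x powr p), 1 / snd x))"
    by (rule continuous_on_compose2 [OF cont_l])
       (use 1 in \<open>auto simp: A_def intro!: continuous_intros\<close>)
  then have 2: "continuous_on A (\<lambda>x. l (1 / snd x) (fst x * of_real (snd x powr p)))" by simp
  have 3: "continuous_on A (\<lambda>x. D (fst x) (snd x))"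
    unfolding D_def using 2 w0 slit k0
    by (intro continuous_intros) (auto simp: A_def)
  have A0: "(w0, k0) \<in> A" using z0w z0 k0 w0 by (simp add: A_def)
  have D0: "D w0 k0 = 0" using w0 k0 by (simp add: D_def z0w)
  obtain e1 where e1: "e1 > 0"
      "\<And>x. x \<in> A \<Longrightarrow> dist x (w0, k0) < e1 \<Longrightarrow> dist (fst x * of_real (snd x powr p)) z0 < \<delta>"
    using 1 [unfolded continuous_on_iff, rule_format, OF A0 \<delta>] z0w by auto
  obtain e2 where e2: "e2 > 0"
      "\<And>x. x \<in> A \<Longrightarrow> dist x (w0, k0) < e2 \<Longrightarrow> norm (D (fst x) (snd x)) < 2 * pi"
    using 3 [unfolded continuous_on_iff, rule_format, OF A0, of "2 * pi"] D0 by auto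
  define e where "e = min e1 e2 / 2"
  have e: "e > 0" "2 * e \<le> e1" "2 * e \<le> e2" using e1 e2 by (auto simp: e_def)
  have m: "min e (norm w0) > 0" using e w0 by simp
  have "norm w0 * k0 powr (1/q) < 1" using nw0 z0 by (simp add: p_def)
  from level_curve_moves_inward [OF w0 k0 this m]
  obtain \<epsilon> where \<epsilon>: "\<epsilon> > 0"
    "\<And>k. k0 < k \<Longrightarrow> k < k0 + \<epsilon> \<Longrightarrow> \<exists>w. norm (w - w0) < min e (norm w0) \<and>
       norm w * k powr (1/q) < norm w0 * k0 powr (1/q) \<and>
       exp (\<alpha> * Ln (w / w0)) * (\<phi> w + of_real (k - 1) * R w) = \<phi> w0 + of_real (k0 - 1) * R w0"
    by metis
  show ?thesis
  proof (rule that [of "min \<epsilon> e"])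
    fix k assume k: "k0 < k" "k < k0 + min \<epsilon> e"
    have k\<epsilon>: "k < k0 + \<epsilon>" using k by simp
    obtain w where w: "norm (w - w0) < e" "norm (w - w0) < norm w0"
       "norm w * k powr p < norm w0 * k0 powr p"
       "exp (\<alpha> * Ln (w / w0)) * (\<phi> w + of_real (k - 1) * R w) = \<phi> w0 + of_real (k0 - 1) * R w0"
      using \<epsilon>(2) [OF k(1) k\<epsilon>] by (auto simp: p_def)
    have k1: "k \<ge> 1" using k k0 by simp
    define z where "z = w * of_real (k powr p)"
    have nz: "norm z < norm z0" using w(3) nw0 by (simp add: z_def norm_mult)
    then have zb: "z \<in> ball 0 1" using z0 by simp
    have wA: "(w, k) \<in> A" using w(2) k1 zb by (simp add: A_def z_def dist_norm norm_minus_commute)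
    have "dist (w, k) (w0, k0) \<le> dist w w0 + dist k k0"
      unfolding dist_Pair_Pair by (rule sqrt_sum_squares_le_sum) auto
    also have "\<dots> < 2 * e" using w(1) k by (simp add: dist_norm)
    finally have dd: "dist (w, k) (w0, k0) < 2 * e" .
    have "norm (z - z0) < \<delta>" using e1(2) [OF wA] dd e by (simp add: z_def dist_norm)
    have N0: "N (1/k0) z0 \<noteq> 0" using N_nonzero z0 k0 by simp
    have kk: "exp (of_real (ln (k / k0))) = (of_real k / of_real k0 :: complex)"
      using k k0 by (simp add: exp_of_real)
    have "exp (D w k) = exp (\<alpha> * Ln (w / w0)) * (of_real k * N (1/k) z) / (of_real k0 * N (1/k0) z0)"
      using exp_l [OF zb, of "1/k"] exp_l [OF z0(1), of "1/k0"] k1 k0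
      by (simp add: D_def exp_add exp_diff kk mult_ac flip: z_def)
    also have "\<dots> = 1"
    proof -
      have "of_real k0 * N (1/k0) z0 = \<phi> w0 + of_real (k0 - 1) * R w0"
        using H [OF k0, of w0] z0w by simp
      moreover have "of_real k * N (1/k) z = \<phi> w + of_real (k - 1) * R w"
        using H [OF k1, of w] by (simp add: z_def)
      moreover have "of_real k0 * N (1/k0) z0 \<noteq> 0" using N0 k0 by simp
      ultimately show ?thesis using w(4) by simp
    qed
    finally have "exp (D w k) = 1" .
    moreover have "norm (D w k) < 2 * pi" using e2(2) [OF wA] dd e by simp
    ultimately have "D w k = 0" by (rule exp_eq_1_small)
    then have "\<alpha> * Ln (w / w0) + l (1/k) z = l (1/k0) z0 - of_real (ln (k / k0))"
      by (simp add: D_def z_def algebra_simps)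
    then have "(\<alpha> * Ln (w / w0) + l (1/k) z) / \<alpha> = (l (1/k0) z0 - of_real (ln (k / k0))) / \<alpha>"
      by simp
    then have eq: "Ln (w / w0) + l (1/k) z / \<alpha> = l (1/k0) z0 / \<alpha> + - of_real (ln (k / k0)) / \<alpha>"
      using alpha_nz by (simp add: add_divide_distrib diff_divide_distrib)
    have wz: "w \<noteq> 0" using slit [of w] w(2) by (auto simp: dist_norm norm_minus_commute)
    have "exp (Ln (w / w0)) * exp (l (1/k) z / \<alpha>)
        = exp (l (1/k0) z0 / \<alpha>) * exp (- of_real (ln (k / k0)) / \<alpha>)"
      by (simp only: eq flip: exp_add)
    then have "w * exp (l (1/k) z / \<alpha>) = w0 * (exp (l (1/k0) z0 / \<alpha>) * exp (- of_real (ln (k / k0)) / \<alpha>))"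
      using wz w0 by (simp add: field_simps)
    then have "L (1/k) z = of_real (k powr p) * w0 *
        (exp (l (1/k0) z0 / \<alpha>) * exp (- of_real (ln (k / k0)) / \<alpha>))"
      by (simp add: L_def z_def)
    also have "of_real (k powr p) * w0 = of_real ((k/k0) powr p) * z0"
      using k0 k by (simp add: powr_divide flip: z0w)
    finally have "L (1/k) z = of_real ((k/k0) powr (1/q)) * exp (- of_real (ln (k/k0)) / \<alpha>) * L (1/k0) z0"
      by (simp add: L_def p_def)
    with nz \<open>norm (z - z0) < \<delta>\<close>
    show "\<exists>z. norm (z - z0) < \<delta> \<and> norm z < norm z0 \<and>
       L (1/k) z = of_real ((k/k0) powr (1/q)) * exp (- of_real (ln (k/k0)) / \<alpha>) * L (1/k0) z0"
      by blast
  qed (use \<epsilon> e in auto)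
qed

lemma L_0_injective: "inj_on (L 0) (ball 0 1)"
proof -
  have N: "N 0 = (\<lambda>z. R 0)" using q_pos by (auto simp: N_def scale_def)
  have "l 0 constant_on ball 0 1"
  proof (rule has_field_derivative_0_imp_constant_on)
    fix z :: complex assume "z \<in> ball 0 1"
    then show "(l 0 has_field_derivative 0) (at z)"
      using l_deriv [of z 0] by (simp add: N)
  qed auto
  then obtain c where "\<And>z. z \<in> ball 0 1 \<Longrightarrow> l 0 z = c" by (auto simp: constant_on_def)
  then show ?thesis by (auto simp: inj_on_def L_def)
qed

lemma L_eq_0_iff: "L t z = 0 \<longleftrightarrow> z = 0"
  by (simp add: L_def)

text \<open>
  The set \<open>T\<close> of bad triples is compact: local injectivity excludes an open neighbourhood \<open>V\<close> of the
  diagonal, so \<open>T\<close> is the difference of a compact and an open set.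
\<close>

theorem L_1_injective: "inj_on (L 1) (ball 0 1)"
proof (rule inj_onI, rule ccontr)
  fix x1 y1 assume xy1: "x1 \<in> ball 0 1" "y1 \<in> ball 0 1" "L 1 x1 = L 1 y1" "x1 \<noteq> y1"
  define r where "r = max (norm x1) (norm y1)"
  have r: "r < 1" using xy1 by (simp add: r_def)
  have sub: "cball 0 r \<subseteq> (ball 0 1 :: complex set)" using r by auto
  define T where "T = {(x, y, t). x \<in> cball 0 r \<and> y \<in> cball 0 r \<and> t \<in> {0..1} \<and> x \<noteq> y \<and> L t x = L t y}"
  define Q :: "(complex \<times> complex \<times> real) set" where "Q = cball 0 r \<times> cball 0 r \<times> {0..1}"
  define W where "W = {u \<in> Q. L (snd (snd u)) (fst u) - L (snd (snd u)) (fst (snd u)) = 0}"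
  have "\<forall>v \<in> ball 0 1 \<times> {0..1}. \<exists>e>0. \<forall>t. 0 \<le> t \<longrightarrow> t \<le> 1 \<longrightarrow> \<bar>t - snd v\<bar> < e \<longrightarrow> inj_on (L t) (ball (fst v) e)"
    using L_locally_injective by (metis atLeastAtMost_iff mem_Times_iff)
  then obtain e where e: "\<And>v. v \<in> ball 0 1 \<times> {0..1} \<Longrightarrow> e v > 0"
    "\<And>v t. v \<in> ball 0 1 \<times> {0..1} \<Longrightarrow> 0 \<le> t \<Longrightarrow> t \<le> 1 \<Longrightarrow> \<bar>t - snd v\<bar> < e v \<Longrightarrow> inj_on (L t) (ball (fst v) (e v))"
    by metis
  define V where "V = (\<Union>v \<in> ball 0 1 \<times> {0..1}. ball (fst v) (e v) \<times> ball (fst v) (e v) \<times> ball (snd v) (e v))"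
  have "open V" unfolding V_def by (intro open_UN ballI open_Times open_ball)
  have TW: "T = W - V"
  proof (intro set_eqI iffI)
    fix u assume u: "u \<in> T"
    then obtain x y t where xyt: "u = (x, y, t)" "x \<in> cball 0 r" "y \<in> cball 0 r" "t \<in> {0..1}"
        "x \<noteq> y" "L t x = L t y" by (auto simp: T_def)
    have "u \<notin> V"
    proof
      assume "u \<in> V"
      then obtain v where v: "v \<in> ball 0 1 \<times> {0..1}" "x \<in> ball (fst v) (e v)" "y \<in> ball (fst v) (e v)"
          "t \<in> ball (snd v) (e v)"
        unfolding V_def xyt by blast
      have "\<bar>t - snd v\<bar> < e v" using v by (simp add: dist_real_def abs_minus_commute)
      then have "inj_on (L t) (ball (fst v) (e v))" using e(2) [OF v(1)] xyt by simp
      with v xyt show False by (meson inj_onD)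
    qed
    then show "u \<in> W - V" using xyt by (simp add: W_def Q_def)
  next
    fix u assume u: "u \<in> W - V"
    obtain x y t where xyt: "u = (x, y, t)" by (cases u)
    have "x \<noteq> y"
    proof
      assume "x = y"
      moreover have "(x, t) \<in> ball 0 1 \<times> {0..1}" using u sub by (auto simp: xyt W_def Q_def)
      ultimately have "u \<in> V" unfolding V_def xyt using e(1) [of "(x, t)"]
        by (intro UN_I [of "(x, t)"]) auto
      with u show False by simp
    qed
    with u show "u \<in> T" by (simp add: T_def W_def Q_def xyt)
  qed
  have "compact Q" unfolding Q_def by (intro compact_Times compact_cball compact_Icc)
  have contQ: "continuous_on Q (\<lambda>u. L (snd (snd u)) (F u))"
    if "continuous_on Q F" "\<And>u. u \<in> Q \<Longrightarrow> F u \<in> cball 0 r" for F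
  proof -
    have "continuous_on Q (\<lambda>u. (\<lambda>(z, t). L t z) (F u, snd (snd u)))"
      by (rule continuous_on_compose2 [OF continuous_L])
         (use that sub in \<open>auto simp: Q_def intro!: continuous_intros\<close>)
    then show ?thesis by simp
  qed
  have "continuous_on Q (\<lambda>u. L (snd (snd u)) (fst u) - L (snd (snd u)) (fst (snd u)))"
    by (intro continuous_intros contQ) (auto simp: Q_def)
  then have "closed W" unfolding W_def
    using \<open>compact Q\<close> by (intro continuous_closed_preimage_constant) (auto simp: compact_imp_closed)
  then have "compact W" using \<open>compact Q\<close> compact_Int_closed [of Q W]
    by (simp add: W_def Int_absorb1 Collect_conj_eq)
  then have cT: "compact T" unfolding TW using \<open>open V\<close> by (rule compact_diff)
  have neT: "T \<noteq> {}"
  proof -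
    have "(x1, y1, 1) \<in> T" using xy1 by (simp add: T_def r_def)
    then show ?thesis by blast
  qed
  have contT: "continuous_on T (\<lambda>u. max (norm (fst u)) (norm (fst (snd u))))"
    by (intro continuous_intros)
  obtain u where u: "u \<in> T"
     "\<And>v. v \<in> T \<Longrightarrow> max (norm (fst u)) (norm (fst (snd u))) \<le> max (norm (fst v)) (norm (fst (snd v)))"
    using continuous_attains_inf [OF cT neT contT] by blast
  obtain x y t where xyt: "u = (x, y, t)" by (cases u)
  have T: "x \<in> cball 0 r" "y \<in> cball 0 r" "0 \<le> t" "t \<le> 1" "x \<noteq> y" "L t x = L t y"
    using u(1) by (auto simp: T_def xyt)
  have xyb: "x \<in> ball 0 1" "y \<in> ball 0 1" using T sub by blast+
  have "t \<noteq> 0" using L_0_injective T xyb by (metis inj_onD)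
  have nz: "x \<noteq> 0" "y \<noteq> 0" using T L_eq_0_iff by metis+
  define k0 where "k0 = 1/t"
  have k0: "k0 \<ge> 1" "t = 1/k0" using T \<open>t \<noteq> 0\<close> by (auto simp: k0_def)
  \<comment> \<open>Displacements below half the distance keep the two moved points distinct.\<close>
  have \<delta>: "norm (x - y) / 2 > 0" using T by simp
  define \<sigma> where "\<sigma> k = of_real ((k/k0) powr (1/q)) * exp (- of_real (ln (k/k0)) / \<alpha>)" for k
  obtain e1 where e1: "e1 > 0" "\<And>k. k0 < k \<Longrightarrow> k < k0 + e1 \<Longrightarrow>
      \<exists>z. norm (z - x) < norm (x - y) / 2 \<and> norm z < norm x \<and> L (1/k) z = \<sigma> k * L t x"
    using L_moves_inward [OF xyb(1) nz(1) k0(1) \<delta>] unfolding \<sigma>_def k0(2) by metis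
  obtain e2 where e2: "e2 > 0" "\<And>k. k0 < k \<Longrightarrow> k < k0 + e2 \<Longrightarrow>
      \<exists>z. norm (z - y) < norm (x - y) / 2 \<and> norm z < norm y \<and> L (1/k) z = \<sigma> k * L t y"
    using L_moves_inward [OF xyb(2) nz(2) k0(1) \<delta>] unfolding \<sigma>_def k0(2) by metis
  define k where "k = k0 + min e1 e2 / 2"
  have k: "k0 < k" "k < k0 + e1" "k < k0 + e2" using e1 e2 by (auto simp: k_def)
  obtain x' where x': "norm (x' - x) < norm (x - y) / 2" "norm x' < norm x" "L (1/k) x' = \<sigma> k * L t x"
    using e1(2) k by blast
  obtain y' where y': "norm (y' - y) < norm (x - y) / 2" "norm y' < norm y" "L (1/k) y' = \<sigma> k * L t y"
    using e2(2) k by blast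
  have "x' \<noteq> y'"
  proof
    assume "x' = y'"
    have "norm (x - y) \<le> norm (x' - x) + norm (x' - y)"
      using norm_triangle_ineq4 [of "x' - y" "x' - x"] by simp
    with x'(1) y'(1) \<open>x' = y'\<close> show False by simp
  qed
  then have "(x', y', 1/k) \<in> T" using x' y' T k k0 by (simp add: T_def)
  then have le: "max (norm x) (norm y) \<le> max (norm x') (norm y')" using u(2) [of "(x', y', 1/k)"] by (simp add: xyt)
  have "norm x' < max (norm x) (norm y)" "norm y' < max (norm x) (norm y)"
    using x'(2) y'(2) by (auto simp only: less_max_iff_disj)
  then have "max (norm x') (norm y') < max (norm x) (norm y)" by (simp only: max_less_iff_conj)
  with le show False by linarith
qed

end

context loewner_pair begin

theorem power_root_univalent:
  obtains m where "m holomorphic_on ball 0 1" "m 0 = 0" "\<And>z. z \<in> ball 0 1 \<Longrightarrow> exp (m z) = \<phi> z"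
    "inj_on (\<lambda>z. z * exp (m z / \<alpha>)) (ball 0 1)"
proof -
  have "contractible (ball (0::complex) 1 \<times> {0..1::real})"
    by (intro convex_imp_contractible convex_Times convex_ball convex_real_interval)
  moreover have "(\<lambda>(z, t). N t z) u \<noteq> 0" if "u \<in> ball (0::complex) 1 \<times> {0..1::real}" for u
    using N_nonzero that by (auto simp del: mem_ball)
  ultimately obtain l' where l': "continuous_on (ball 0 1 \<times> {0..1}) l'"
      "\<And>u. u \<in> ball 0 1 \<times> {0..1} \<Longrightarrow> (\<lambda>(z, t). N t z) u = exp (l' u)"
    using continuous_logarithm_on_contractible [OF continuous_N] by metis
  define l where "l t z = l' (z, t)" for t z
  interpret loewner_log \<alpha> q \<phi> R l
  proof
    show "continuous_on (ball 0 1 \<times> {0..1}) (\<lambda>(z, t). l t z)" using l' by (simp add: l_def)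
    show "exp (l t z) = N t z" if "z \<in> ball 0 1" "0 \<le> t" "t \<le> 1" for z t
      using l'(2) [of "(z, t)"] that by (simp add: l_def)
  qed
  define m where "m z = l 1 z - l 1 0" for z
  have N1: "N 1 z = \<phi> z" for z by (simp add: N_def scale_def)
  show ?thesis
  proof (rule that [of m])
    show "m holomorphic_on ball 0 1"
    proof -
      have "l 1 holomorphic_on ball 0 1"
        unfolding holomorphic_on_open [OF open_ball] using l_deriv [of _ 1]
        by (meson order_refl zero_le_one)
      then show ?thesis unfolding m_def by (intro holomorphic_intros)
    qed
    show "m 0 = 0" by (simp add: m_def)
    show "exp (m z) = \<phi> z" if "z \<in> ball 0 1" for z
      using exp_l [of z 1] exp_l [of 0 1] that by (simp add: m_def exp_diff N1 phi_0)
    have "z * exp (m z / \<alpha>) = L 1 z * exp (- l 1 0 / \<alpha>)" for z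
      by (simp add: m_def L_def diff_divide_distrib exp_diff exp_minus field_simps)
    then show "inj_on (\<lambda>z. z * exp (m z / \<alpha>)) (ball 0 1)"
      using L_1_injective by (simp add: inj_on_def)
  qed
qed

end

section \<open>The integral as a solution of an Euler equation\<close>

text \<open>
  If \<open>\<psi> = \<Sum> b\<^sub>n z\<^sup>n\<close> then \<open>\<phi> = \<Sum> \<alpha>/(\<alpha>+n) b\<^sub>n z\<^sup>n\<close>.  For \<open>Re \<alpha> > 0\<close> the factors \<open>\<alpha>/(\<alpha>+n)\<close> have modulus
  at most 1, so the series converges on the whole disc.
\<close>

lemma euler_equation_solution:
  fixes \<alpha> :: complex
  assumes \<alpha>: "0 < Re \<alpha>" and hol: "\<psi> holomorphic_on ball 0 1"
  obtains \<phi> where "\<phi> holomorphic_on ball 0 1" "\<phi> 0 = \<psi> 0"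
    "\<And>z. z \<in> ball 0 1 \<Longrightarrow> \<alpha> * \<phi> z + z * deriv \<phi> z = \<alpha> * \<psi> z"
proof -
  define b where "b n = (deriv ^^ n) \<psi> 0 / fact n" for n
  define c where "c n = \<alpha> / (\<alpha> + of_nat n) * b n" for n
  define \<phi> where "\<phi> z = (\<Sum>n. c n * z ^ n)" for z
  have b: "(\<lambda>n. b n * z ^ n) sums \<psi> z" if "z \<in> ball 0 1" for z
    using holomorphic_power_series [OF hol that] by (simp add: b_def)
  have nz: "\<alpha> + of_nat n \<noteq> 0" for n
  proof -
    have "0 < Re (\<alpha> + of_nat n)" using \<alpha> by simp
    then show ?thesis by force
  qed
  have cb: "norm (c n) \<le> norm (b n)" for n
  proof -
    have "norm \<alpha> \<le> norm (\<alpha> + of_nat n)"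
      using \<alpha> by (auto simp: cmod_def intro!: power_mono)
    then have "norm (\<alpha> / (\<alpha> + of_nat n)) \<le> 1" by (simp add: norm_divide divide_le_eq)
    then show ?thesis unfolding c_def norm_mult by (intro mult_left_le_one_le) auto
  qed
  have sc: "summable (\<lambda>n. c n * z ^ n)" if z: "z \<in> ball 0 1" for z
  proof -
    define x :: complex where "x = of_real ((1 + norm z) / 2)"
    have nx: "norm x = (1 + norm z) / 2" unfolding x_def norm_of_real by simp
    have x: "x \<in> ball 0 1" "norm z < norm x" using z by (auto simp: nx)
    have "summable (\<lambda>n. norm (b n * z ^ n))"
      using powser_insidea [OF sums_summable [OF b [OF x(1)]] x(2)] .
    then show ?thesis
      by (rule summable_comparison_test' [of _ 0]) (auto simp: norm_mult intro: mult_right_mono cb)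
  qed
  have d: "\<alpha> * \<phi> z + z * deriv \<phi> z = \<alpha> * \<psi> z" if z: "z \<in> ball 0 1" for z
  proof -
    define x :: complex where "x = of_real ((1 + norm z) / 2)"
    have nx: "norm x = (1 + norm z) / 2" unfolding x_def norm_of_real by simp
    have x: "x \<in> ball 0 1" "norm z < norm x" using z by (auto simp: nx)
    have "(\<phi> has_field_derivative (\<Sum>n. diffs c n * z ^ n)) (at z)"
      unfolding \<phi>_def [abs_def] by (rule termdiffs_strong [OF sc [OF x(1)] x(2)])
    then have dz: "deriv \<phi> z = (\<Sum>n. diffs c n * z ^ n)" by (rule DERIV_imp_deriv)
    have "summable (\<lambda>n. diffs c n * z ^ n)"
      by (rule termdiff_converges [of z 1]) (use z sc in auto)
    from diffs_equiv [OF this] have "(\<lambda>n. z * (of_nat n * c n * z ^ (n - Suc 0))) sums (z * deriv \<phi> z)"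
      unfolding dz by (rule sums_mult)
    moreover have "z * (of_nat n * c n * z ^ (n - Suc 0)) = of_nat n * c n * z ^ n" for n
      by (cases n) auto
    ultimately have "(\<lambda>n. of_nat n * c n * z ^ n) sums (z * deriv \<phi> z)" by simp
    moreover have "(\<lambda>n. \<alpha> * (c n * z ^ n)) sums (\<alpha> * \<phi> z)"
      unfolding \<phi>_def by (intro sums_mult summable_sums sc z)
    ultimately have "(\<lambda>n. \<alpha> * (c n * z ^ n) + of_nat n * c n * z ^ n) sums (\<alpha> * \<phi> z + z * deriv \<phi> z)"
      by (intro sums_add)
    moreover have "\<alpha> * (c n * z ^ n) + of_nat n * c n * z ^ n = \<alpha> * (b n * z ^ n)" for n
    proof -
      have "\<alpha> * (c n * z ^ n) + of_nat n * c n * z ^ n = (\<alpha> + of_nat n) * c n * z ^ n"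
        by (simp add: algebra_simps)
      also have "\<dots> = \<alpha> * (b n * z ^ n)" using nz [of n] by (simp add: c_def)
      finally show ?thesis .
    qed
    ultimately have "(\<lambda>n. \<alpha> * (b n * z ^ n)) sums (\<alpha> * \<phi> z + z * deriv \<phi> z)" by simp
    moreover have "(\<lambda>n. \<alpha> * (b n * z ^ n)) sums (\<alpha> * \<psi> z)" by (intro sums_mult b z)
    ultimately show ?thesis by (rule sums_unique2)
  qed
  have "\<phi> holomorphic_on ball 0 1"
    by (rule power_series_holomorphic [of 0 1 c]) (use sc in \<open>auto simp: \<phi>_def intro: summable_sums\<close>)
  moreover have "\<phi> 0 = \<psi> 0" using d [of 0] \<alpha> by auto
  ultimately show ?thesis using d that by blast
qed

text \<open>
  The Euler equation says that \<open>t\<^sup>\<alpha> \<phi>(t z)\<close> is a primitive of \<open>\<alpha> t\<^sup>\<alpha>\<^sup>-\<^sup>1 \<psi>(t z)\<close>; it is continuous at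
  \<open>t = 0\<close> since \<open>Re \<alpha> > 0\<close>.
\<close>

lemma euler_equation_integral:
  fixes \<alpha> :: complex
  assumes \<alpha>: "0 < Re \<alpha>" and hol: "\<phi> holomorphic_on ball 0 1"
    and eq: "\<And>z. z \<in> ball 0 1 \<Longrightarrow> \<alpha> * \<phi> z + z * deriv \<phi> z = \<alpha> * \<psi> z"
    and z: "z \<in> ball 0 1"
  shows "((\<lambda>t. of_real t powr (\<alpha> - 1) * \<psi> (of_real t * z)) has_integral \<phi> z / \<alpha>) {0..1}"
proof -
  have \<alpha>0: "\<alpha> \<noteq> 0" using \<alpha> by auto
  have tz: "of_real t * z \<in> ball 0 1" if "t \<in> {0..1}" for t :: real
  proof -
    have "\<bar>t\<bar> * norm z \<le> 1 * norm z" using that by (intro mult_right_mono) auto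
    then show ?thesis using z by (simp add: norm_mult)
  qed
  define y where "y t = of_real t powr \<alpha> * \<phi> (of_real t * z) / \<alpha>" for t :: real
  have "((\<lambda>t. of_real t powr (\<alpha> - 1) * \<psi> (of_real t * z)) has_integral y 1 - y 0) {0..1}"
  proof (rule fundamental_theorem_of_calculus_interior)
    have "continuous_on {0..1} (\<lambda>t::real. \<phi> (of_real t * z))"
      by (rule continuous_on_compose2 [OF holomorphic_on_imp_continuous_on [OF hol]])
         (use tz in \<open>auto intro!: continuous_intros simp del: mem_ball\<close>)
    then show "continuous_on {0..1} y"
      unfolding y_def using \<alpha> \<alpha>0
      by (intro continuous_intros continuous_on_powr_complex) auto
    fix t :: real assume t: "t \<in> {0<..<1}"
    have tb: "of_real t * z \<in> ball 0 1" using tz t by (simp del: mem_ball)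
    have dphi: "(\<phi> has_field_derivative deriv \<phi> (of_real t * z)) (at (of_real t * z))"
      using hol tb holomorphic_derivI by blast
    have "((\<lambda>u. \<phi> (u * z)) has_field_derivative deriv \<phi> (of_real t * z) * z) (at (of_real t))"
      by (rule DERIV_chain2 [where f = \<phi> and g = "\<lambda>u. u * z", OF dphi]) (auto intro!: derivative_eq_intros)
    then have "((\<lambda>u. u powr \<alpha> * \<phi> (u * z) / \<alpha>) has_field_derivative
      (\<alpha> * of_real t powr (\<alpha> - 1) * \<phi> (of_real t * z)
        + (deriv \<phi> (of_real t * z) * z) * of_real t powr \<alpha>) / \<alpha>) (at (of_real t))"
      using t by (intro DERIV_cdivide DERIV_mult has_field_derivative_powr) auto
    also have "(\<alpha> * of_real t powr (\<alpha> - 1) * \<phi> (of_real t * z)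
        + (deriv \<phi> (of_real t * z) * z) * of_real t powr \<alpha>) / \<alpha>
      = of_real t powr (\<alpha> - 1) * \<psi> (of_real t * z)"
    proof -
      have "of_real t powr \<alpha> = of_real t powr (\<alpha> - 1) * of_real t"
        using powr_add [of "of_real t" "\<alpha> - 1" 1] t by simp
      then have "\<alpha> * of_real t powr (\<alpha> - 1) * \<phi> (of_real t * z)
        + (deriv \<phi> (of_real t * z) * z) * of_real t powr \<alpha>
        = of_real t powr (\<alpha> - 1) * (\<alpha> * \<phi> (of_real t * z) + (of_real t * z) * deriv \<phi> (of_real t * z))"
        by (simp add: algebra_simps)
      then show ?thesis unfolding eq [OF tb] using \<alpha>0 by simp
    qed
    finally show "(y has_vector_derivative of_real t powr (\<alpha> - 1) * \<psi> (of_real t * z)) (at t)"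
      unfolding y_def [abs_def] by (rule has_vector_derivative_real_field)
  qed auto
  then show ?thesis using \<alpha>0 by (simp add: y_def)
qed

section \<open>Branches of the powers and the univalence criterion\<close>

lemma quot_id_holomorphic:
  assumes "g \<in> class_A"
  shows "quot_id g holomorphic_on unit_disc"
  by (rule pole_theorem_open_0 [of g _ 0]) (use assms in \<open>auto simp: class_A_def quot_id_def\<close>)

lemma quot_id_log_deriv:
  assumes g: "g \<in> class_A" and z: "z \<in> unit_disc" and nz: "z \<noteq> 0 \<Longrightarrow> g z \<noteq> 0"
  shows "z * deriv (quot_id g) z / quot_id g z = log_deriv_quot g z - 1"
proof (cases "z = 0")
  case False
  have "(g has_field_derivative deriv g z) (at z)"
    using g z holomorphic_derivI by (auto simp: class_A_def)
  then have "((\<lambda>u. g u / u) has_field_derivative (deriv g z * z - g z * 1) / (z * z)) (at z)"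
    using False by (intro DERIV_divide DERIV_ident)
  then have "(quot_id g has_field_derivative (deriv g z * z - g z * 1) / (z * z)) (at z)"
    by (rule has_field_derivative_transform_within_open [of _ _ _ "- {0}"])
       (use False in \<open>auto simp: quot_id_def\<close>)
  then have "deriv (quot_id g) z = (deriv g z * z - g z * 1) / (z * z)" by (rule DERIV_imp_deriv)
  then show ?thesis using False nz by (simp add: quot_id_def log_deriv_quot_def field_simps)
qed (simp add: log_deriv_quot_def)

lemma Ln_eq_continuous_log:
  fixes l :: "complex \<Rightarrow> complex"
  assumes "l holomorphic_on ball 0 1" "l 0 = 0"
  shows "\<forall>\<^sub>F z in nhds 0. Ln (exp (l z)) = l z"
proof -
  have "(l \<longlongrightarrow> 0) (nhds 0)"
    using holomorphic_tendsto_nhds [OF assms(1) open_ball, of 0] assms(2) by simp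
  then have "\<forall>\<^sub>F z in nhds 0. dist (l z) 0 < pi" by (rule tendstoD) simp
  then show ?thesis
  proof (rule eventually_mono)
    fix z assume "dist (l z) 0 < pi"
    then have "\<bar>Im (l z)\<bar> < pi" using abs_Im_le_cmod [of "l z"] by simp
    then show "Ln (exp (l z)) = l z" by (intro Ln_exp) auto
  qed
qed

text \<open>
  The global branch of \<open>(g(u)/u)\<^sup>\<alpha>\<^sup>-\<^sup>1\<close>.  For \<open>\<alpha> = 1\<close> the function \<open>g\<close> may have zeros in the disc, so
  no logarithm of \<open>g(u)/u\<close> exists in general, but the branch is the constant 1.
\<close>

lemma g_power_branch:
  assumes g: "g \<in> class_A" and gnz: "\<And>z. \<alpha> \<noteq> 1 \<Longrightarrow> z \<in> unit_disc \<Longrightarrow> z \<noteq> 0 \<Longrightarrow> g z \<noteq> 0"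
  obtains P where "P holomorphic_on unit_disc" "P 0 = 1" "\<And>z. z \<in> unit_disc \<Longrightarrow> P z \<noteq> 0"
    "\<And>z. z \<in> unit_disc \<Longrightarrow> z * deriv P z / P z = (\<alpha> - 1) * (log_deriv_quot g z - 1)"
    "\<forall>\<^sub>F z in nhds 0. quot_id g z powr (\<alpha> - 1) = P z"
proof (cases "\<alpha> = 1")
  case True
  have "(quot_id g \<longlongrightarrow> 1) (nhds 0)"
    using holomorphic_tendsto_nhds [OF quot_id_holomorphic [OF g] open_ball, of 0]
    by (simp add: quot_id_def)
  then have "\<forall>\<^sub>F z in nhds 0. quot_id g z \<noteq> 0" by (rule tendsto_imp_eventually_ne) simp
  then have "\<forall>\<^sub>F z in nhds 0. quot_id g z powr (\<alpha> - 1) = 1"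
    by (rule eventually_mono) (simp add: True)
  then show ?thesis using True by (intro that [of "\<lambda>_. 1"]) auto
next
  case False
  define Q where "Q = quot_id g"
  have holQ: "Q holomorphic_on unit_disc" unfolding Q_def using quot_id_holomorphic g .
  have Qnz: "Q z \<noteq> 0" if "z \<in> unit_disc" for z
    using gnz [OF False that] by (auto simp: Q_def quot_id_def)
  obtain l0 where l0: "l0 holomorphic_on unit_disc" "\<And>z. z \<in> unit_disc \<Longrightarrow> exp (l0 z) = Q z"
    using holomorphic_logarithm_exists [OF convex_ball open_ball holQ Qnz, of 0] by auto
  define l where "l z = l0 z - l0 0" for z
  have Q0: "Q 0 = 1" by (simp add: Q_def quot_id_def)
  have l: "l holomorphic_on unit_disc" "l 0 = 0"
    unfolding l_def using l0 by (auto intro!: holomorphic_intros)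
  have el: "exp (l z) = Q z" if "z \<in> unit_disc" for z
    using l0(2) [OF that] l0(2) [of 0] Q0 by (simp add: l_def exp_diff)
  define P where "P z = exp ((\<alpha> - 1) * l z)" for z
  show ?thesis
  proof (rule that [of P])
    show "P holomorphic_on unit_disc" unfolding P_def using l by (auto intro!: holomorphic_intros)
    show "P 0 = 1" "\<And>z. P z \<noteq> 0" using l by (auto simp: P_def)
    show "z * deriv P z / P z = (\<alpha> - 1) * (log_deriv_quot g z - 1)" if z: "z \<in> unit_disc" for z
    proof -
      have "(l has_field_derivative deriv Q z / Q z) (at z)"
        by (rule continuous_log_imp_holomorphic [OF open_ball holQ _ el z])
           (use l holomorphic_on_imp_continuous_on in auto)
      then have "(P has_field_derivative P z * ((\<alpha> - 1) * (deriv Q z / Q z))) (at z)"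
        unfolding P_def [abs_def] by (auto intro!: derivative_eq_intros)
      then have "deriv P z = P z * ((\<alpha> - 1) * (deriv Q z / Q z))" by (rule DERIV_imp_deriv)
      then have "z * deriv P z / P z = (\<alpha> - 1) * (z * deriv Q z / Q z)"
        by (simp add: P_def)
      then show ?thesis
        using quot_id_log_deriv [OF g z gnz [OF False z]] by (simp add: Q_def)
    qed
    have "\<forall>\<^sub>F z in nhds 0. z \<in> unit_disc" by (rule eventually_nhds_in_open) auto
    with Ln_eq_continuous_log [OF l]
    show "\<forall>\<^sub>F z in nhds 0. quot_id g z powr (\<alpha> - 1) = P z"
    proof eventually_elim
      case (elim z)
      have "quot_id g z = exp (l z)" using el elim(2) by (simp add: Q_def)
      then show ?case using elim(1) by (simp add: powr_def P_def)
    qed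
  qed
qed

theorem theorem3p1:
  fixes \<alpha> c s h\<^sub>0 :: complex and a b m :: real and f g h :: "complex \<Rightarrow> complex"
  assumes "c \<notin> \<real>\<^sub>\<ge>\<^sub>0"
    and "s = of_real a + \<i> * of_real b" and "a > 0" and "m > 0"
    and "f \<in> class_A" and "g \<in> class_A"
    and "h holomorphic_on unit_disc" and "h 0 = h\<^sub>0" and "h\<^sub>0 \<notin> \<real>\<^sub>\<le>\<^sub>0"
    and "\<And>z. z \<in> unit_disc \<Longrightarrow> h z \<noteq> 0"
    and "\<And>z. z \<in> unit_disc \<Longrightarrow> deriv f z \<noteq> 0"
    and "\<And>z. \<alpha> \<noteq> 1 \<Longrightarrow> z \<in> unit_disc \<Longrightarrow> z \<noteq> 0 \<Longrightarrow> g z \<noteq> 0"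
    and "norm (\<alpha> - of_real (m / (2 * a))) < m / (2 * a)"
    and "\<And>z. z \<in> unit_disc \<Longrightarrow>
           norm (c / h z + of_real m / (2 * \<alpha>)) < m / (2 * norm \<alpha>)"
    and "\<And>z. z \<in> unit_disc \<Longrightarrow>
           norm (- c * \<alpha> / (of_real a * h z) * of_real (norm z powr (m / a))
                 + of_real (1 - norm z powr (m / a))
                   * ((\<alpha> - 1) * log_deriv_quot g z + 1
                      + z * deriv (deriv f) z / deriv f z + z * deriv h z / h z)
                 - of_real (m / (2 * a)))
           \<le> m / (2 * a)"
  shows "extends_univalently (G_fun \<alpha> f g)"
proof -
  note a = \<open>a > 0\<close> and hnz = assms(10) and fnz = assms(11)
  have c: "c \<noteq> 0" using assms(1) by auto
  define q where "q = m / a"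
  have q2: "q / 2 = m / (2 * a)" by (simp add: q_def)
  have alpha_disc: "norm (\<alpha> - of_real (q / 2)) < q / 2" unfolding q2 using assms(13) .
  note alpha = disc_halfplane [OF alpha_disc]
  obtain P where P: "P holomorphic_on unit_disc" "P 0 = 1" "\<And>z. z \<in> unit_disc \<Longrightarrow> P z \<noteq> 0"
    "\<And>z. z \<in> unit_disc \<Longrightarrow> z * deriv P z / P z = (\<alpha> - 1) * (log_deriv_quot g z - 1)"
    "\<forall>\<^sub>F z in nhds 0. quot_id g z powr (\<alpha> - 1) = P z"
    using g_power_branch [OF assms(6,12)] by blast
  define \<psi> where "\<psi> z = P z * deriv f z" for z
  have holf': "deriv f holomorphic_on unit_disc"
    using assms(5) by (auto simp: class_A_def intro!: holomorphic_deriv)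
  have hol\<psi>: "\<psi> holomorphic_on unit_disc"
    unfolding \<psi>_def by (intro holomorphic_intros P holf')
  have \<psi>0: "\<psi> 0 = 1" using P(2) assms(5) by (simp add: \<psi>_def class_A_def)
  obtain \<phi> where \<phi>: "\<phi> holomorphic_on unit_disc" "\<phi> 0 = \<psi> 0"
    "\<And>z. z \<in> unit_disc \<Longrightarrow> \<alpha> * \<phi> z + z * deriv \<phi> z = \<alpha> * \<psi> z"
    using euler_equation_solution [OF alpha(1) hol\<psi>] by blast
  \<comment> \<open>The normalisation of \<open>R\<close> makes \<open>\<alpha> \<psi> / R\<close> equal to \<open>-c \<alpha> / (a h)\<close>, and \<open>\<alpha> + w R' / R\<close> equal to
    the bracket in the third inequality.\<close>
  define R where "R z = - (of_real a / c) * (\<psi> z * h z)" for z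
  have R_nz: "R z \<noteq> 0" if "z \<in> unit_disc" for z
    using that a c P(3) fnz hnz by (simp add: R_def \<psi>_def)
  have J: "(\<alpha> * \<phi> z + z * deriv \<phi> z) / R z = - c * \<alpha> / (of_real a * h z)" if "z \<in> unit_disc" for z
    unfolding \<phi>(3) [OF that] using that a c P(3) fnz hnz by (simp add: R_def \<psi>_def field_simps)
  have B: "\<alpha> + z * deriv R z / R z = (\<alpha> - 1) * log_deriv_quot g z + 1
      + z * deriv (deriv f) z / deriv f z + z * deriv h z / h z" if z: "z \<in> unit_disc" for z
  proof -
    have nz: "P z \<noteq> 0" "deriv f z \<noteq> 0" "h z \<noteq> 0" using P(3) fnz hnz z by auto
    have dP: "(P has_field_derivative deriv P z) (at z)"
      and df: "(deriv f has_field_derivative deriv (deriv f) z) (at z)"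
      and dh: "(h has_field_derivative deriv h z) (at z)"
      using P(1) holf' assms(7) z holomorphic_derivI by blast+
    have "(R has_field_derivative - (of_real a / c) *
       ((deriv P z * deriv f z + deriv (deriv f) z * P z) * h z + deriv h z * (P z * deriv f z))) (at z)"
      unfolding R_def [abs_def] \<psi>_def by (intro DERIV_cmult DERIV_mult dP df dh)
    then have dR: "deriv R z = - (of_real a / c) *
       ((deriv P z * deriv f z + deriv (deriv f) z * P z) * h z + deriv h z * (P z * deriv f z))"
      by (rule DERIV_imp_deriv)
    have "z * deriv R z / R z
        = z * deriv P z / P z + z * deriv (deriv f) z / deriv f z + z * deriv h z / h z"
      unfolding dR R_def \<psi>_def using nz a c by (simp add: field_simps)
    then show ?thesis unfolding P(4) [OF z] by (simp add: algebra_simps)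
  qed
  interpret loewner_pair \<alpha> q \<phi> R
  proof
    show "norm (\<alpha> - of_real (q / 2)) < q / 2" by (rule alpha_disc)
    show "\<phi> holomorphic_on ball 0 1" "\<phi> 0 = 1" using \<phi> \<psi>0 by auto
    show "R holomorphic_on ball 0 1"
      unfolding R_def by (intro holomorphic_intros hol\<psi> assms)
    fix z :: complex assume z: "z \<in> ball 0 1"
    show "R z \<noteq> 0" using R_nz z .
    \<comment> \<open>This is the second inequality multiplied by \<open>|\<alpha>|/a\<close>.\<close>
    have "norm ((\<alpha> * \<phi> z + z * deriv \<phi> z) / R z - of_real (q / 2))
        = norm (- (\<alpha> / of_real a) * (c / h z + of_real m / (2 * \<alpha>)))"
      unfolding J [OF z] using a alpha(2) hnz [OF z] by (intro arg_cong [of _ _ norm]) (simp add: q_def field_simps)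
    also have "\<dots> = norm \<alpha> / a * norm (c / h z + of_real m / (2 * \<alpha>))"
      using a by (simp add: norm_mult norm_divide)
    also have "\<dots> < norm \<alpha> / a * (m / (2 * norm \<alpha>))"
      using a alpha(2) by (intro mult_strict_left_mono assms(14) z) auto
    also have "\<dots> = q / 2" using a alpha(2) by (simp add: q_def)
    finally show "norm ((\<alpha> * \<phi> z + z * deriv \<phi> z) / R z - of_real (q / 2)) < q / 2" .
    show "norm (of_real (norm z powr q) * ((\<alpha> * \<phi> z + z * deriv \<phi> z) / R z)
        + of_real (1 - norm z powr q) * (\<alpha> + z * deriv R z / R z) - of_real (q/2)) \<le> q/2"
      unfolding J [OF z] B [OF z] q2 using assms(15) [OF z] by (simp add: q_def mult.commute)
  qed
  obtain l where l: "l holomorphic_on ball 0 1" "l 0 = 0" "\<And>z. z \<in> ball 0 1 \<Longrightarrow> exp (l z) = \<phi> z"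
    "inj_on (\<lambda>z. z * exp (l z / \<alpha>)) (ball 0 1)"
    using power_root_univalent by blast
  obtain d where d: "d > 0" "\<And>z. z \<in> ball 0 d \<Longrightarrow> quot_id g z powr (\<alpha> - 1) = P z"
    using P(5) unfolding eventually_nhds_metric by (auto simp: dist_commute)
  \<comment> \<open>Near 0 the principal power in the integral is the branch \<open>P\<close>, so the integral is \<open>\<phi>(z)/\<alpha>\<close>.\<close>
  have phi: "phi_fun \<alpha> f g z = \<phi> z" if z: "z \<in> ball 0 d" "z \<in> unit_disc" for z
  proof -
    have "integral {0..1} (\<lambda>t::real. of_real t powr (\<alpha> - 1)
            * quot_id g (of_real t * z) powr (\<alpha> - 1) * deriv f (of_real t * z))
        = integral {0..1} (\<lambda>t::real. of_real t powr (\<alpha> - 1) * \<psi> (of_real t * z))"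
    proof (rule integral_cong)
      fix t :: real assume t: "t \<in> {0..1}"
      have "\<bar>t\<bar> * norm z \<le> 1 * norm z" using t by (intro mult_right_mono) auto
      then have "of_real t * z \<in> ball 0 d" using z by (simp add: norm_mult)
      then show "of_real t powr (\<alpha> - 1) * quot_id g (of_real t * z) powr (\<alpha> - 1) * deriv f (of_real t * z)
          = of_real t powr (\<alpha> - 1) * \<psi> (of_real t * z)"
        by (simp only: d(2) \<psi>_def mult.assoc)
    qed
    also have "\<dots> = \<phi> z / \<alpha>"
      using euler_equation_integral [OF alpha(1) \<phi>(1,3) z(2)] by (rule integral_unique)
    finally show ?thesis using alpha(2) by (simp add: phi_fun_def)
  qed
  define F where "F z = z * exp (l z / \<alpha>)" for z
  have "\<forall>\<^sub>F z in nhds 0. z \<in> unit_disc" "\<forall>\<^sub>F z in nhds 0. z \<in> ball 0 d"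
    using d(1) by (intro eventually_nhds_in_open; simp)+
  with Ln_eq_continuous_log [OF l(1,2)] have "\<forall>\<^sub>F z in nhds 0. F z = G_fun \<alpha> f g z"
  proof eventually_elim
    case (elim z)
    have "\<phi> z powr (1 / \<alpha>) = exp (l z) powr (1 / \<alpha>)" by (simp only: l(3) [OF elim(2)])
    also have "\<dots> = exp (l z / \<alpha>)" by (simp add: powr_def elim(1))
    finally have "\<phi> z powr (1 / \<alpha>) = exp (l z / \<alpha>)" .
    then show ?case using phi [OF elim(3,2)] by (simp add: F_def G_fun_def)
  qed
  moreover have "F holomorphic_on unit_disc"
    unfolding F_def using alpha(2) by (intro holomorphic_intros l(1)) auto
  moreover have "inj_on F unit_disc" using l(4) by (simp add: F_def [abs_def])
  ultimately show ?thesis unfolding extends_univalently_def by blast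
qed

end
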